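(* Let $d \geq 1$ be an integer and let $A \subseteq \mathbb{R}^d$ be a relatively dense set. Then the following conditions are equivalent: (1) $D^+(A-A) < \infty$; (2) $A-A$ is uniformly discrete; (3) $A$ is uniformly discrete and $A - A \subseteq A + F$ for some finite set $F \subseteq \mathbb{R}^d$; (4) $A \subseteq M + F$ for some cut-and-project set $M \subseteq \mathbb{R}^d$ and some finite set $F \subseteq \mathbb{R}^d$.
   Context: $\mathbb{R}^d$ is equipped with the supremum norm $\|\cdot\|_\infty$. For sets $A,B \subseteq \mathbb{R}^d$, $A+B = \{a+b : a\in A, b\in B\}$ and $A-B = \{a-b : a \in A, b \in B\}$. A set $A \subseteq \mathbb{R}^d$ is relatively dense if there is $R>0$ such that every closed ball of radius $R$ contains a point of $A$. It is uniformly discrete if there is $r>0$ such that every open ball of radius $r$ contains at most one point of $A$. The upper uniform density of $A \subseteq \mathbb{R}^d$ is $$D^+(A) = \limsup_{L\to\infty} \sup_{x \in \mathbb{R}^d} (2L)^{-d}\, |\{a \in A : \|a-x\|_\infty < L\}|.$$ A cut-and-project set in $\mathbb{R}^d$ is a set of the form $M = \pi_1(\Gamma \cap (\mathbb{R}^d \times \Omega))$, where $e \geq 0$ is an integer, $\pi_1 \colon \mathbb{R}^d \times \mathbb{R}^e \to \mathbb{R}^d$ is the projection onto the first coordinate, $\Gamma$ is a discrete subgroup of $\mathbb{R}^{d+e} = \mathbb{R}^d\times\mathbb{R}^e$, and $\Omega \subseteq \mathbb{R}^e$ is open and bounded. (No further conditions are imposed; in particular $\Gamma$ need not be a lattice,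 $\pi_1|_\Gamma$ need not be injective, and the projection of $\Gamma$ to $\mathbb{R}^e$ need not be dense.) *)

theory Defs
  imports "HOL-Analysis.Analysis" "HOL-Library.Function_Algebras"
begin

text \<open>
  Throughout, \<open>\<real>\<^sup>d\<close> is \<^typ>\<open>real ^ 'd\<close> and the supremum norm is \<^const>\<open>infnorm\<close>.
  The Minkowski sum \<open>A + B\<close> is the one of \<^theory>\<open>HOL-Library.Set_Algebras\<close>; the infix minus on sets,
  however, is set-theoretic difference, hence the separate constant below.
\<close>

definition difference_set :: "'a::ab_group_add set \<Rightarrow> 'a set \<Rightarrow> 'a set"
  where "difference_set A B = {a - b |a b. a \<in> A \<and> b \<in> B}"

definition relatively_dense :: "(real ^ 'd) set \<Rightarrow> bool"
  where "relatively_dense A \<longleftrightarrow> (\<exists>R>0. \<forall>x. \<exists>a\<in>A. infnorm (a - x) \<le> R)"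

definition uniformly_discrete :: "(real ^ 'd) set \<Rightarrow> bool"
  where "uniformly_discrete A \<longleftrightarrow>
    (\<exists>r>0. \<forall>x. \<forall>a\<in>A. \<forall>b\<in>A. infnorm (a - x) < r \<longrightarrow> infnorm (b - x) < r \<longrightarrow> a = b)"

text \<open>
  Points are counted with \<open>emeasure (count_space UNIV)\<close>, which is \<open>\<infinity>\<close> on infinite sets,
  whereas \<^const>\<open>card\<close> would be \<open>0\<close>.
\<close>

definition upper_uniform_density :: "(real ^ 'd) set \<Rightarrow> ennreal"
  where "upper_uniform_density A =
    Limsup at_top (\<lambda>L::real. SUP x. ennreal (1 / (2 * L) ^ CARD('d))
      * emeasure (count_space UNIV) {a \<in> A. infnorm (a - x) < L})"

text \<open>
  Since the internal dimension \<open>e\<close> is existentially quantified (and may be \<open>0\<close>), \<open>\<real>\<^sup>e\<close> is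
  \<^term>\<open>Euclidean_space e\<close>, i.e. the sequences \<open>nat \<Rightarrow> real\<close> vanishing from index \<open>e\<close> on, with
  the topology of coordinatewise convergence. Group operations are pointwise. Discreteness of a subgroup
  means that its subspace topology is discrete.
\<close>

definition discrete_subgroup :: "nat \<Rightarrow> ((real ^ 'd) \<times> (nat \<Rightarrow> real)) set \<Rightarrow> bool"
  where "discrete_subgroup e \<Gamma> \<longleftrightarrow>
    \<Gamma> \<subseteq> UNIV \<times> topspace (Euclidean_space e) \<and>
    0 \<in> \<Gamma> \<and> (\<forall>g\<in>\<Gamma>. \<forall>h\<in>\<Gamma>. g + h \<in> \<Gamma>) \<and> (\<forall>g\<in>\<Gamma>. - g \<in> \<Gamma>) \<and>
    subtopology (prod_topology euclidean (Euclidean_space e)) \<Gamma> = discrete_topology \<Gamma>"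

text \<open>
  Boundedness is spelled out coordinatewise, because \<^const>\<open>bounded\<close> on \<^typ>\<open>nat \<Rightarrow> real\<close>
  refers to a bounded metric and would be vacuous.
\<close>

definition bounded_Euclidean :: "nat \<Rightarrow> (nat \<Rightarrow> real) set \<Rightarrow> bool"
  where "bounded_Euclidean e \<Omega> \<longleftrightarrow> (\<exists>B. \<forall>y\<in>\<Omega>. \<forall>i<e. \<bar>y i\<bar> \<le> B)"

definition cut_and_project :: "(real ^ 'd) set \<Rightarrow> bool"
  where "cut_and_project M \<longleftrightarrow>
    (\<exists>e \<Gamma> \<Omega>. discrete_subgroup e \<Gamma> \<and> openin (Euclidean_space e) \<Omega> \<and> bounded_Euclidean e \<Omega> \<and>
      M = fst ` (\<Gamma> \<inter> (UNIV \<times> \<Omega>)))"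

end

theory Submission
  imports Defs
begin

text \<open>
  Write \<open>D = A - A\<close>. All four conditions are compared with one further condition: the set
  \<open>D - D\<close> has only finitely many points in each ball (\<open>finite_on_balls\<close>). From it one reads off
  the uniform discreteness of \<open>D\<close>, since differences of distinct points of \<open>D\<close> cannot
  accumulate at \<open>0\<close>, and also the inclusion \<open>A - A \<subseteq> A + F\<close>: if \<open>a\<close> is a point of \<open>A\<close> within
  \<open>R\<close> of \<open>x \<in> A - A\<close>, then \<open>x - a\<close> is an element of \<open>A - A - A\<close> of norm at most \<open>R\<close>.

  From finite density of \<open>D\<close> the condition on \<open>D - D\<close> follows by additive combinatorics.
  Relative density makes the part \<open>B\<close> of \<open>A\<close> in a ball of radius \<open>L\<close> have at least a constant times \<open>L\<^sup>d\<close> points, whereas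
  finite density of \<open>D\<close> gives \<open>B - B\<close> at most a constant times \<open>L\<^sup>d\<close> points. So \<open>B\<close> has bounded
  difference constant \<open>K\<close>, uniformly in \<open>L\<close>. The Pluennecke and Ruzsa inequalities then cover
  \<open>(B - B) - (B - B)\<close> by \<open>K\<^sup>5\<close> translates of \<open>B - B\<close>
  (\<open>small_difference_iterated\<close>). As this number does not depend on \<open>L\<close>, a ball contains at most
  \<open>K\<^sup>5\<close> times as many points of \<open>D - D\<close> as a ball of comparable size can contain points of \<open>D\<close>.

  If \<open>A - A \<subseteq> A + F\<close>, then \<open>D - D\<close> lies in a finite union of translates of the
  uniformly discrete set \<open>A\<close>. If \<open>A \<subseteq> M + F\<close> with
  \<open>M\<close> a cut-and-project set, then \<open>D - D\<close> lies in a finite union of translates of a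
  cut-and-project set with a four times larger window, and a discrete subgroup is finite in bounded boxes. That uniform discreteness of \<open>D\<close> implies its finite
  density is a packing argument.

  The remaining step, from the condition on \<open>D - D\<close> to a cut-and-project set, has two parts.
  Halving repeatedly, \<open>a = 2 h + g\<close> with \<open>h \<in> A\<close> close to \<open>a / 2\<close> and \<open>g\<close> in the finite set of short elements of
  \<open>A - A - A\<close>, shows that \<open>A\<close> lies in a finitely generated group, on which there are additive
  integer-valued coordinates \<open>\<phi>\<^sub>1, \<dots>, \<phi>\<^sub>s\<close> and vectors \<open>b\<^sub>1, \<dots>, b\<^sub>s\<close> with \<open>x = \<Sum> \<phi>\<^sub>i x b\<^sub>i\<close>.
  If \<open>p v\<close> is a point of \<open>A\<close> near \<open>v\<close>, then \<open>p (u + v) - p u - p v\<close> ranges over a finite set,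
  so \<open>v \<mapsto> \<phi>\<^sub>i (p v)\<close> is additive up to a bounded error and, by Hyers's theorem, within bounded
  distance of a linear form \<open>l\<^sub>i\<close>. Hence \<open>\<phi>\<^sub>i - l\<^sub>i\<close> is bounded on \<open>A\<close>. The points
  \<open>(\<Sum> z\<^sub>i b\<^sub>i, (z\<^sub>i - l\<^sub>i (\<Sum> z\<^sub>j b\<^sub>j))\<^sub>i)\<close> with integral \<open>z\<close> form a discrete subgroup, and those over
  \<open>A\<close> with \<open>z\<^sub>i = \<phi>\<^sub>i a\<close> have their second components in a bounded window.
\<close>

section \<open>Sumsets and difference sets\<close>

lemma difference_setI: "a \<in> A \<Longrightarrow> b \<in> B \<Longrightarrow> a - b \<in> difference_set A B"
  unfolding difference_set_def by blast

lemma difference_setE: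
  assumes "x \<in> difference_set A B"
  obtains a b where "a \<in> A" "b \<in> B" "x = a - b"
  using assms unfolding difference_set_def by blast

lemma difference_set_twiceE:
  assumes "x \<in> difference_set (difference_set A A) (difference_set A A)"
  obtains a b c d where "a \<in> A" "b \<in> A" "c \<in> A" "d \<in> A" "x = (a - b) - (c - d)"
  using assms unfolding difference_set_def by blast

lemma difference_set_mono: "A \<subseteq> A' \<Longrightarrow> B \<subseteq> B' \<Longrightarrow> difference_set A B \<subseteq> difference_set A' B'"
  unfolding difference_set_def by blast

lemma difference_set_eq_plus: "difference_set A B = A + uminus ` B"
proof -
  have "difference_set A B = (\<lambda>(a, b). a - b) ` (A \<times> B)" unfolding difference_set_def by auto
  also have "\<dots> = (\<lambda>(a, b). a + b) ` (A \<times> uminus ` B)" by force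
  finally show ?thesis by (simp add: set_plus_image)
qed

lemma uminus_image_plus:
  fixes A B :: "'a::ab_group_add set"
  shows "uminus ` (A + B) = uminus ` A + uminus ` B"
proof (intro set_eqI iffI)
  fix x assume "x \<in> uminus ` (A + B)"
  then obtain a b where "a \<in> A" "b \<in> B" "x = - a + - b"
    by (auto elim!: set_plus_elim simp: minus_add_distrib)
  then show "x \<in> uminus ` A + uminus ` B" by blast
next
  fix x assume "x \<in> uminus ` A + uminus ` B"
  then obtain a b where "a \<in> A" "b \<in> B" "x = - (a + b)"
    by (auto elim!: set_plus_elim simp: minus_add_distrib)
  then show "x \<in> uminus ` (A + B)" by blast
qed

text \<open>
  This is Petridis's form of the Pluennecke inequality. The set \<open>X\<close> minimises the growth ratio
  \<open>card (Y + B) / card Y\<close> over its own subsets. In the induction, passing from \<open>C\<close> to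
  \<open>insert c C\<close> adds to \<open>C + X + B\<close> at most the points \<open>c + (X + B)\<close> outside \<open>c + (Y + B)\<close>, where
  \<open>Y\<close> collects the \<open>x\<close> for which \<open>c + x + B\<close> was there before. Minimality bounds their number by
  \<open>K\<close> times \<open>card X - card Y\<close>, and at least \<open>card X - card Y\<close> points are added to \<open>C + X\<close>.
\<close>

lemma petridis:
  fixes X B C :: "'a::ab_group_add set" and K :: real
  assumes fX: "finite X" and fB: "finite B" and fC: "finite C"
    and K0: "0 \<le> K" and K: "real (card (X + B)) = K * card X"
    and min: "\<And>Y. Y \<subseteq> X \<Longrightarrow> K * card Y \<le> card (Y + B)"
  shows "card (C + X + B) \<le> K * card (C + X)"
  using fC
proof (induction C)
  case empty
  have "({}::'a set) + X + B = {}" "({}::'a set) + X = {}" by (auto simp: set_plus_def)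
  then show ?case by (metis card.empty mult_zero_right of_nat_0 order_refl)
next
  case (insert c C)
  define P where "P = C + X + B"
  define Y where "Y = {x \<in> X. (+) (c + x) ` B \<subseteq> P}"
  \<comment> \<open>The points \<open>c + x\<close> with \<open>x \<in> W\<close> are not new in \<open>insert c C + X\<close>; such an \<open>x\<close> lies in \<open>Y\<close>.\<close>
  define W where "W = {x \<in> X. c + x \<in> C + X}"
  have WY: "W \<subseteq> Y" unfolding W_def Y_def P_def by (auto intro: set_plus_intro)
  have YX: "Y \<subseteq> X" by (auto simp: Y_def)
  note fin = fX fB insert(1)
  have fP: "finite P" unfolding P_def using fin by (intro finite_set_plus)
  have fYB: "finite (Y + B)" and fXB: "finite (X + B)"
    using fin YX by (auto intro: finite_set_plus finite_subset)
  have YB: "Y + B \<subseteq> X + B" using YX by (rule set_plus_mono2) simp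
  have "insert c C + X + B \<subseteq> P \<union> (+) c ` ((X + B) - (Y + B))"
  proof
    fix p assume "p \<in> insert c C + X + B"
    then obtain c' x b where p: "p = c' + x + b" "c' \<in> insert c C" "x \<in> X" "b \<in> B"
      by (auto elim!: set_plus_elim)
    show "p \<in> P \<union> (+) c ` ((X + B) - (Y + B))"
    proof (cases "p \<in> P")
      case False
      then have c: "c' = c" using p by (auto simp: P_def)
      have "x + b \<notin> Y + B"
      proof
        assume "x + b \<in> Y + B"
        then obtain y b' where "x + b = y + b'" "y \<in> Y" "b' \<in> B" by (auto elim!: set_plus_elim)
        then have "c + (y + b') \<in> P" by (auto simp: Y_def add.assoc)
        then show False using False p c \<open>x + b = y + b'\<close> by (simp add: add.assoc)
      qed
      then show ?thesis using p c by (auto simp: add.assoc)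
    qed auto
  qed
  then have "card (insert c C + X + B) \<le> card (P \<union> (+) c ` ((X + B) - (Y + B)))"
    using fP fXB by (intro card_mono) auto
  also have "\<dots> \<le> card P + card ((+) c ` ((X + B) - (Y + B)))" by (rule card_Un_le)
  also have "card ((+) c ` ((X + B) - (Y + B))) \<le> card ((X + B) - (Y + B))"
    using fXB by (intro card_image_le) auto
  also have "card ((X + B) - (Y + B)) = card (X + B) - card (Y + B)"
    by (rule card_Diff_subset[OF fYB YB])
  finally have 1: "real (card (insert c C + X + B)) \<le> card P + (real (card (X + B)) - card (Y + B))"
    using card_mono[OF fXB YB] by linarith
  have "card (C + X) + (card X - card W) = card (C + X) + card (X - W)"
    using fX by (subst card_Diff_subset) (auto simp: W_def)
  also have "card (X - W) = card ((+) c ` (X - W))"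
    by (rule card_image[symmetric]) (auto simp: inj_on_def)
  also have "card (C + X) + card ((+) c ` (X - W)) = card ((C + X) \<union> (+) c ` (X - W))"
    using fin by (intro card_Un_disjoint[symmetric]) (auto simp: W_def intro: finite_set_plus)
  also have "\<dots> \<le> card (insert c C + X)"
    using fin by (intro card_mono) (auto intro: finite_set_plus elim!: set_plus_elim)
  finally have 2: "real (card (C + X)) + (real (card X) - real (card Y)) \<le> card (insert c C + X)"
    using card_mono[OF finite_subset[OF YX fX] WY] card_mono[OF fX YX] by linarith
  have "card P + (real (card (X + B)) - card (Y + B))
    \<le> K * (real (card (C + X)) + (real (card X) - real (card Y)))"
    using insert(3) min[OF YX] K by (simp add: P_def algebra_simps)
  also have "\<dots> \<le> K * card (insert c C + X)" by (rule mult_left_mono[OF 2 K0])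
  finally show ?case using 1 by linarith
qed

text \<open>
  Fix a representation \<open>d = y d - z d\<close> of each difference. Then
  \<open>(x, d) \<mapsto> (x + y d, x + z d)\<close> is injective, since the difference of the two components
  recovers \<open>d\<close>.
\<close>

lemma ruzsa_triangle:
  fixes X Y Z :: "'a::ab_group_add set"
  assumes fin: "finite X" "finite Y" "finite Z"
  shows "card X * card (difference_set Y Z) \<le> card (X + Y) * card (X + Z)"
proof -
  have "\<forall>d\<in>difference_set Y Z. \<exists>y z. y \<in> Y \<and> z \<in> Z \<and> d = y - z"
    by (auto simp: difference_set_def)
  then obtain y z where yz: "\<And>d. d \<in> difference_set Y Z \<Longrightarrow> y d \<in> Y \<and> z d \<in> Z \<and> d = y d - z d"
    by metis
  let ?f = "\<lambda>(x, d). (x + y d, x + z d)"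
  have "inj_on ?f (X \<times> difference_set Y Z)"
  proof (rule inj_onI, clarify)
    fix x d x' d' assume "x \<in> X" "d \<in> difference_set Y Z" "x' \<in> X" "d' \<in> difference_set Y Z"
      and eq: "x + y d = x' + y d'" "x + z d = x' + z d'"
    then have "d = y d - z d" "d' = y d' - z d'" using yz by blast+
    then have "d = (x + y d) - (x + z d)" "d' = (x' + y d') - (x' + z d')" by simp_all
    then have "d = d'" by (simp only: eq)
    then show "x = x' \<and> d = d'" using eq by simp
  qed
  then have "card (X \<times> difference_set Y Z) \<le> card ((X + Y) \<times> (X + Z))"
    using fin yz by (intro card_inj_on_le[of ?f]) (auto intro: finite_set_plus)
  then show ?thesis by (simp add: card_cartesian_product)
qed

text \<open>
  Take a maximal \<open>T \<subseteq> X\<close> for which the translates \<open>t + B\<close> are pairwise disjoint. Each further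
  \<open>x + B\<close> meets one of them, so \<open>x \<in> t + (B - B)\<close>, and disjointness bounds \<open>card T\<close>.
\<close>

lemma ruzsa_covering:
  fixes X B :: "'a::ab_group_add set"
  assumes fin: "finite X" "finite B" and ne: "B \<noteq> {}"
  obtains T where "T \<subseteq> X" "X \<subseteq> T + difference_set B B" "card T * card B \<le> card (X + B)"
proof -
  define ok where "ok T \<longleftrightarrow> T \<subseteq> X \<and> (\<forall>t\<in>T. \<forall>t'\<in>T. t \<noteq> t' \<longrightarrow> (+) t ` B \<inter> (+) t' ` B = {})" for T
  have "finite {T. ok T}" by (rule finite_subset[of _ "Pow X"]) (use fin in \<open>auto simp: ok_def\<close>)
  moreover have "{} \<in> {T. ok T}" by (auto simp: ok_def)
  ultimately obtain T where T: "ok T" and max: "\<And>T'. ok T' \<Longrightarrow> T \<subseteq> T' \<Longrightarrow> T' = T"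
    using finite_has_maximal[of "{T. ok T}"] by (metis empty_iff mem_Collect_eq)
  have TX: "T \<subseteq> X" using T by (simp add: ok_def)
  have "x \<in> T + difference_set B B" if x: "x \<in> X" for x
  proof (cases "x \<in> T")
    case True
    obtain b where "b \<in> B" using ne by auto
    then have "b - b \<in> difference_set B B" unfolding difference_set_def by blast
    then have "x + (b - b) \<in> T + difference_set B B" by (rule set_plus_intro[OF True])
    then show ?thesis by simp
  next
    case False
    then have "\<not> ok (insert x T)" using max[of "insert x T"] by auto
    then obtain t where t: "t \<in> T" "(+) x ` B \<inter> (+) t ` B \<noteq> {}"
      using T x unfolding ok_def by (auto simp: Int_commute)
    then obtain b b' where b: "b \<in> B" "b' \<in> B" "x + b = t + b'" by auto
    then have "x = t + (b' - b)" by (simp add: algebra_simps)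
    then show ?thesis using t(1) b by (auto simp: difference_set_def intro!: set_plus_intro)
  qed
  moreover have "card T * card B \<le> card (X + B)"
  proof -
    have fT: "finite T" using fin TX by (auto intro: finite_subset)
    have "card (\<Union>t\<in>T. (+) t ` B) = (\<Sum>t\<in>T. card ((+) t ` B))"
      using T fT fin by (intro card_UN_disjoint) (auto simp: ok_def)
    also have "\<dots> = card T * card B" by (simp add: card_image)
    finally have "card T * card B = card (\<Union>t\<in>T. (+) t ` B)" ..
    also have "\<dots> \<le> card (X + B)"
      using fin TX by (intro card_mono) (auto intro: finite_set_plus)
    finally show ?thesis .
  qed
  ultimately show ?thesis using that[of T] TX by blast
qed

text \<open>
  The bound on the number of translates depends on \<open>K\<close> alone. Covering by translates of
  \<open>A - A\<close> reduces, by Ruzsa's covering argument with \<open>B = - A\<close>, to a bound on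
  \<open>(B + B + B) - (B + B)\<close>. Petridis's inequality bounds \<open>X + (B + B)\<close> and \<open>X + (B + B + B)\<close> by
  \<open>K\<^sup>2\<close> and \<open>K\<^sup>3\<close> times \<open>card X\<close> for an optimal \<open>X \<subseteq> A\<close>, and the triangle inequality combines them.
\<close>

lemma small_difference_iterated:
  fixes A :: "'a::ab_group_add set" and K :: real
  assumes fA: "finite A" and ne: "A \<noteq> {}"
    and small: "card (difference_set A A) \<le> K * card A"
  obtains T where "T \<subseteq> difference_set (difference_set A A) (difference_set A A)"
    "difference_set (difference_set A A) (difference_set A A) \<subseteq> T + difference_set A A"
    "card T \<le> K ^ 5"
proof -
  define B where "B = uminus ` A"
  have fB: "finite B" and neB: "B \<noteq> {}" and cB: "card B = card A"
    using fA ne by (auto simp: B_def card_image)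
  have mB: "uminus ` B = A" by (simp add: B_def image_image)
  have AB: "difference_set A A = A + B"
    by (simp add: difference_set_eq_plus B_def)
  have BB: "difference_set B B = A + B"
    by (simp add: difference_set_eq_plus mB add.commute)
  \<comment> \<open>Petridis's inequality needs a subset of \<open>A\<close> with the smallest growth ratio.\<close>
  define q where "q Y = real (card (Y + B)) / card Y" for Y
  have fP: "finite {Y. Y \<subseteq> A \<and> Y \<noteq> {}}" by (rule finite_subset[of _ "Pow A"]) (use fA in auto)
  have neP: "{Y. Y \<subseteq> A \<and> Y \<noteq> {}} \<noteq> {}" using ne by auto
  define X where "X = arg_min_on q {Y. Y \<subseteq> A \<and> Y \<noteq> {}}"
  have X: "X \<subseteq> A" "X \<noteq> {}"
    using arg_min_if_finite(1)[OF fP neP, of q] by (auto simp: X_def)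
  have Xmin: "q X \<le> q Y" if "Y \<subseteq> A" "Y \<noteq> {}" for Y
    using arg_min_if_finite(2)[OF fP neP, of q] that by (auto simp: X_def not_less)
  define k where "k = q X"
  have fX: "finite X" using X fA finite_subset by auto
  have cX: "card X > 0" "card A > 0" using X fX fA ne by (auto simp: card_gt_0_iff)
  have k0: "0 \<le> k" by (simp add: k_def q_def)
  have "k \<le> q A" unfolding k_def using Xmin ne by auto
  also have "q A \<le> K" using small cX by (simp add: q_def AB divide_simps)
  finally have kK: "k \<le> K" .
  have pet: "card (C + X + B) \<le> k * card (C + X)" if "finite C" for C
  proof (rule petridis[OF fX fB that k0])
    show "real (card (X + B)) = k * card X" using cX by (simp add: k_def q_def)
    fix Y assume Y: "Y \<subseteq> X"
    show "k * card Y \<le> card (Y + B)"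
    proof (cases "Y = {}")
      case False
      then have "card Y > 0" using Y fX finite_subset by (auto simp: card_gt_0_iff)
      moreover have "k \<le> q Y" unfolding k_def using Xmin Y X False by auto
      ultimately show ?thesis by (simp add: q_def divide_simps)
    qed simp
  qed
  have c1: "card (X + B) \<le> k * card X"
    using cX by (simp add: k_def q_def)
  have "card (X + (B + B)) \<le> k * card (X + B)"
    using pet[OF fB] by (simp add: ac_simps)
  also have "\<dots> \<le> k * (k * card X)" using c1 k0 by (rule mult_left_mono)
  finally have c2: "card (X + (B + B)) \<le> k^2 * card X" by (simp add: power2_eq_square)
  have "card (X + (B + B + B)) \<le> k * card (X + (B + B))"
    using pet[of "B + B"] fB by (simp add: ac_simps finite_set_plus)
  also have "\<dots> \<le> k * (k^2 * card X)" using c2 k0 by (rule mult_left_mono)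
  finally have c3: "card (X + (B + B + B)) \<le> k^3 * card X" by (simp add: power2_eq_square power3_eq_cube)
  define E where "E = difference_set (difference_set A A) (difference_set A A)"
  have E: "E = A + A + B + B"
    unfolding E_def AB difference_set_eq_plus
    by (simp add: uminus_image_plus mB B_def[symmetric] ac_simps)
  have EB: "E + B = difference_set (B + B + B) (B + B)"
    unfolding E difference_set_eq_plus
    by (simp add: uminus_image_plus mB ac_simps)
  have fE: "finite E" unfolding E using fA fB by (intro finite_set_plus)
  obtain T where T: "T \<subseteq> E" "E \<subseteq> T + difference_set B B" "card T * card B \<le> card (E + B)"
    using ruzsa_covering[OF fE fB neB] by metis
  have "card T * card A * card X \<le> card X * card (E + B)"
    using mult_le_mono1[OF T(3), of "card X"] by (simp add: cB mult.commute)
  also have "\<dots> \<le> card (X + (B + B + B)) * card (X + (B + B))"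
    unfolding EB using fX fB by (intro ruzsa_triangle finite_set_plus)
  finally have "real (card T * card A * card X) \<le> real (card (X + (B + B + B)) * card (X + (B + B)))"
    by (rule of_nat_mono)
  also have "\<dots> \<le> (k^3 * card X) * (k^2 * card X)"
    unfolding of_nat_mult using c2 c3 k0 by (intro mult_mono) auto
  also have "\<dots> = k^5 * card X * card X" by (simp add: eval_nat_numeral)
  also have "\<dots> \<le> k^5 * card A * card X" 
    using k0 card_mono[OF fA X(1)] by (intro mult_right_mono mult_left_mono) auto
  finally have "real (card T) \<le> k^5" using cX by (simp add: mult.assoc)
  also have "\<dots> \<le> K^5" by (rule power_mono[OF kK k0])
  finally show ?thesis using that[of T] T BB AB unfolding E_def by auto
qed

section \<open>Counting separated points\<close>

text \<open>
  The points fall into the cells of a grid of mesh \<open>r\<close> in the coordinates \<open>f i\<close>, at most one in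
  each. The summand \<open>2\<close> allows for the two boundary cells in each direction.
\<close>

lemma separated_finite_card:
  fixes f :: "'i \<Rightarrow> 'a \<Rightarrow> real"
  assumes I: "finite I" and r: "r > 0" and \<rho>: "\<rho> \<ge> 0"
    and bdd: "\<And>x i. x \<in> S \<Longrightarrow> i \<in> I \<Longrightarrow> \<bar>f i x\<bar> \<le> \<rho>"
    and sep: "\<And>x y. x \<in> S \<Longrightarrow> y \<in> S \<Longrightarrow> (\<And>i. i \<in> I \<Longrightarrow> \<bar>f i x - f i y\<bar> < r) \<Longrightarrow> x = y"
  shows "finite S" and "real (card S) \<le> (2 * \<rho> / r + 2) ^ card I"
proof -
  define g where "g x = restrict (\<lambda>i. \<lfloor>f i x / r\<rfloor>) I" for x
  define J where "J = {\<lfloor>- \<rho> / r\<rfloor>..\<lfloor>\<rho> / r\<rfloor>}"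
  have inj: "inj_on g S"
  proof (rule inj_onI)
    fix x y assume xy: "x \<in> S" "y \<in> S" "g x = g y"
    show "x = y"
    proof (rule sep[OF xy(1,2)])
      fix i assume "i \<in> I"
      then have "\<lfloor>f i x / r\<rfloor> = \<lfloor>f i y / r\<rfloor>" using fun_cong[OF xy(3), of i] by (simp add: g_def)
      then have "\<bar>f i x / r - f i y / r\<bar> < 1" by linarith
      then show "\<bar>f i x - f i y\<bar> < r" 
        using r by (simp add: diff_divide_distrib[symmetric] divide_less_eq)
    qed
  qed
  have sub: "g ` S \<subseteq> I \<rightarrow>\<^sub>E J"
  proof
    fix h assume "h \<in> g ` S"
    then obtain x where x: "x \<in> S" "h = g x" by auto
    have "\<lfloor>f i x / r\<rfloor> \<in> J" if "i \<in> I" for i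
      using bdd[OF x(1) that] r unfolding J_def atLeastAtMost_iff
      by (intro conjI floor_mono divide_right_mono) auto
    then show "h \<in> I \<rightarrow>\<^sub>E J" by (auto simp: x(2) g_def)
  qed
  have fin: "finite (I \<rightarrow>\<^sub>E J)" using I by (intro finite_PiE) (auto simp: J_def)
  then show "finite S" using inj sub by (metis finite_subset finite_imageD)
  have "card S = card (g ` S)" using inj by (simp add: card_image)
  also have "\<dots> \<le> card (I \<rightarrow>\<^sub>E J)" using fin sub by (rule card_mono)
  also have "\<dots> = card J ^ card I" using I by (simp add: card_PiE)
  finally have "real (card S) \<le> real (card J) ^ card I" by (metis of_nat_mono of_nat_power)
  also have "\<dots> \<le> (2 * \<rho> / r + 2) ^ card I"
  proof (rule power_mono)
    have "0 \<le> \<rho> / r" using r \<rho> by simp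
    then show "real (card J) \<le> 2 * \<rho> / r + 2" unfolding J_def by simp linarith
  qed simp
  finally show "real (card S) \<le> (2 * \<rho> / r + 2) ^ card I" .
qed

lemma infnorm_le_iff: "infnorm (x :: real ^ 'd) \<le> r \<longleftrightarrow> (\<forall>i. \<bar>x $ i\<bar> \<le> r)"
  by (auto simp: infnorm_Max Basis_vec_def inner_axis axis_eq_axis intro: order_trans[OF component_le_infnorm_cart])

lemma infnorm_less_iff: "infnorm (x :: real ^ 'd) < r \<longleftrightarrow> (\<forall>i. \<bar>x $ i\<bar> < r)"
  by (auto simp: infnorm_Max Basis_vec_def inner_axis axis_eq_axis)

lemma uniformly_discrete_iff:
  "uniformly_discrete A \<longleftrightarrow> (\<exists>r>0. \<forall>a\<in>A. \<forall>b\<in>A. infnorm (a - b) < r \<longrightarrow> a = b)"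
proof
  assume "uniformly_discrete A"
  then obtain r where "r > 0" 
    and r: "\<And>x a b. a \<in> A \<Longrightarrow> b \<in> A \<Longrightarrow> infnorm (a - x) < r \<Longrightarrow> infnorm (b - x) < r \<Longrightarrow> a = b"
    unfolding uniformly_discrete_def by blast
  then show "\<exists>r>0. \<forall>a\<in>A. \<forall>b\<in>A. infnorm (a - b) < r \<longrightarrow> a = b"
    by (intro exI[of _ r]) (auto simp: infnorm_0)
next
  assume "\<exists>r>0. \<forall>a\<in>A. \<forall>b\<in>A. infnorm (a - b) < r \<longrightarrow> a = b"
  then obtain r where "r > 0" and r: "\<And>a b. a \<in> A \<Longrightarrow> b \<in> A \<Longrightarrow> infnorm (a - b) < r \<Longrightarrow> a = b"
    by blast
  have "a = b" if "a \<in> A" "b \<in> A" "infnorm (a - x) < r / 2" "infnorm (b - x) < r / 2" for a b x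
  proof (rule r[OF that(1,2)])
    have "infnorm (a - b) \<le> infnorm (a - x) + infnorm (x - b)"
      using infnorm_triangle[of "a - x" "x - b"] by simp
    then show "infnorm (a - b) < r" using that(3,4) by (simp add: infnorm_sub)
  qed
  then show "uniformly_discrete A"
    unfolding uniformly_discrete_def using \<open>r > 0\<close> by (intro exI[of _ "r / 2"]) auto
qed

lemma uniformly_discrete_card_ball:
  fixes A :: "(real ^ 'd) set"
  assumes r: "r > 0" and sep: "\<And>a b. a \<in> A \<Longrightarrow> b \<in> A \<Longrightarrow> infnorm (a - b) < r \<Longrightarrow> a = b"
    and L: "L \<ge> 0"
  shows "finite {a \<in> A. infnorm (a - x) < L}"
    and "real (card {a \<in> A. infnorm (a - x) < L}) \<le> (2 * L / r + 2) ^ CARD('d)"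
proof -
  let ?f = "\<lambda>i a. (a - x) $ i"
  have b: "\<And>a i. a \<in> {a \<in> A. infnorm (a - x) < L} \<Longrightarrow> i \<in> UNIV \<Longrightarrow> \<bar>?f i a\<bar> \<le> L"
    by (auto intro: order_trans[OF component_le_infnorm_cart] simp del: vector_minus_component)
  have s: "\<And>a b. a \<in> {a \<in> A. infnorm (a - x) < L} \<Longrightarrow> b \<in> {a \<in> A. infnorm (a - x) < L} \<Longrightarrow>
    (\<And>i. i \<in> UNIV \<Longrightarrow> \<bar>?f i a - ?f i b\<bar> < r) \<Longrightarrow> a = b"
    by (rule sep) (auto simp: infnorm_less_iff)
  note * = separated_finite_card[of "UNIV :: 'd set" r L "{a \<in> A. infnorm (a - x) < L}" ?f, OF finite r L b s]
  show "finite {a \<in> A. infnorm (a - x) < L}"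
    by (rule *(1))
  show "real (card {a \<in> A. infnorm (a - x) < L}) \<le> (2 * L / r + 2) ^ CARD('d)"
    by (rule *(2))
qed

section \<open>Sets that are finite on balls\<close>

definition finite_on_balls :: "(real ^ 'd) set \<Rightarrow> bool"
  where "finite_on_balls S \<longleftrightarrow> (\<forall>\<rho>. finite {x \<in> S. infnorm x \<le> \<rho>})"

lemma finite_on_ballsD: "finite_on_balls S \<Longrightarrow> finite {x \<in> S. infnorm x \<le> \<rho>}"
  by (simp add: finite_on_balls_def)

lemma finite_on_balls_subset: "finite_on_balls T \<Longrightarrow> S \<subseteq> T \<Longrightarrow> finite_on_balls S"
  unfolding finite_on_balls_def
proof
  fix \<rho> assume T: "\<forall>\<rho>. finite {x \<in> T. infnorm x \<le> \<rho>}" and "S \<subseteq> T"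
  then have "{x \<in> S. infnorm x \<le> \<rho>} \<subseteq> {x \<in> T. infnorm x \<le> \<rho>}" by blast
  then show "finite {x \<in> S. infnorm x \<le> \<rho>}" using T finite_subset by blast
qed

lemma finite_on_balls_plus_finite:
  assumes S: "finite_on_balls S" and F: "finite F"
  shows "finite_on_balls (S + F)"
  unfolding finite_on_balls_def
proof
  fix \<rho>
  have "{x \<in> S + F. infnorm x \<le> \<rho>} \<subseteq> (\<Union>f\<in>F. (\<lambda>s. s + f) ` {s \<in> S. infnorm s \<le> \<rho> + infnorm f})"
  proof
    fix x assume "x \<in> {x \<in> S + F. infnorm x \<le> \<rho>}"
    then obtain s f where x: "x = s + f" "s \<in> S" "f \<in> F" "infnorm (s + f) \<le> \<rho>"
      by (auto elim!: set_plus_elim)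
    have "infnorm s \<le> infnorm (s + f) + infnorm f"
      using infnorm_triangle[of "s + f" "- f"] by (simp add: infnorm_neg)
    then show "x \<in> (\<Union>f\<in>F. (\<lambda>s. s + f) ` {s \<in> S. infnorm s \<le> \<rho> + infnorm f})"
      using x by (intro UN_I[of f] image_eqI[of _ _ s]) auto
  qed
  then show "finite {x \<in> S + F. infnorm x \<le> \<rho>}"
    by (rule finite_subset) (use S F in \<open>auto simp: finite_on_ballsD\<close>)
qed

lemma uniformly_discrete_imp_finite_on_balls:
  assumes "uniformly_discrete A"
  shows "finite_on_balls A"
proof -
  obtain r where r: "r > 0" "\<And>a b. a \<in> A \<Longrightarrow> b \<in> A \<Longrightarrow> infnorm (a - b) < r \<Longrightarrow> a = b"
    using assms unfolding uniformly_discrete_iff by blast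
  have "finite {a \<in> A. infnorm a \<le> \<rho>}" for \<rho>
    by (rule finite_subset[OF _ uniformly_discrete_card_ball(1)[where L = "max 0 \<rho> + 1" and x = 0, OF r]]) auto
  then show ?thesis by (simp add: finite_on_balls_def)
qed

text \<open>
  Finitely many differences lie in the unit ball; the smallest nonzero norm among them, or \<open>1\<close>, is a separation constant.
\<close>

lemma finite_on_balls_difference_imp_uniformly_discrete:
  assumes "finite_on_balls (difference_set A A)"
  shows "uniformly_discrete A"
proof -
  define N where "N = infnorm ` ({x \<in> difference_set A A. infnorm x \<le> 1} - {0})"
  have fin: "finite (insert 1 N)" using finite_on_ballsD[OF assms, of 1] by (simp add: N_def)
  define r where "r = Min (insert 1 N)"
  have "r > 0" unfolding r_def using fin by (subst Min_gr_iff) (auto simp: N_def infnorm_pos_lt)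
  have r1: "r \<le> 1" unfolding r_def using fin by (intro Min_le) auto
  have "a = b" if ab: "a \<in> A" "b \<in> A" "infnorm (a - b) < r" for a b
  proof (rule ccontr)
    assume "a \<noteq> b"
    then have "infnorm (a - b) \<in> insert 1 N"
      using ab r1 by (auto simp: N_def difference_set_def intro!: imageI)
    then have "r \<le> infnorm (a - b)" unfolding r_def using fin by (intro Min_le)
    then show False using ab by simp
  qed
  then show ?thesis unfolding uniformly_discrete_iff using \<open>r > 0\<close> by blast
qed

section \<open>Upper uniform density\<close>

text \<open>
  A finite limit superior controls all large radii at once, uniformly in the centre; in
  particular the counted sets are finite.
\<close>

lemma finite_upper_uniform_densityD:
  fixes S :: "(real ^ 'd) set"
  assumes "upper_uniform_density S < \<infinity>"
  obtains K L0 :: real where "K \<ge> 0" "L0 > 0"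
    "\<And>L x. L \<ge> L0 \<Longrightarrow> finite {a \<in> S. infnorm (a - x) < L}"
    "\<And>L x. L \<ge> L0 \<Longrightarrow> card {a \<in> S. infnorm (a - x) < L} \<le> K * L ^ CARD('d)"
proof -
  obtain k where k: "k \<ge> 0" "upper_uniform_density S = ennreal k"
    using assms by (cases "upper_uniform_density S") auto
  define K where "K = k + 1"
  have K: "upper_uniform_density S < ennreal K" "K \<ge> 0"
    using k by (auto simp: K_def ennreal_less_iff)
  obtain L1 where L1: "\<And>L. L \<ge> L1 \<Longrightarrow> (SUP x. ennreal (1 / (2 * L) ^ CARD('d))
      * emeasure (count_space UNIV) {a \<in> S. infnorm (a - x) < L}) < ennreal K"
    using Limsup_lessD[OF K(1)[unfolded upper_uniform_density_def]]
    by (auto simp: eventually_at_top_linorder)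
  have *: "finite {a \<in> S. infnorm (a - x) < L} \<and>
      card {a \<in> S. infnorm (a - x) < L} \<le> K * 2 ^ CARD('d) * L ^ CARD('d)" if L: "L \<ge> max 1 L1" for L x
  proof -
    let ?B = "{a \<in> S. infnorm (a - x) < L}"
    define g where "g y = ennreal (1 / (2 * L) ^ CARD('d))
      * emeasure (count_space UNIV) {a \<in> S. infnorm (a - y) < L}" for y
    have "g x \<le> (SUP y. g y)" by (rule SUP_upper[OF UNIV_I])
    also have "\<dots> < ennreal K" using L1[of L] L by (simp only: g_def max.bounded_iff)
    finally have *: "ennreal (1 / (2 * L) ^ CARD('d)) * emeasure (count_space UNIV) ?B < ennreal K"
      by (simp only: g_def)
    moreover
    have pos: "1 / (2 * L) ^ CARD('d) > 0" using L by simp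
    ultimately have fin: "finite ?B"
      using L by (cases "finite ?B") (auto simp: emeasure_count_space_infinite ennreal_mult_top)
    have e: "emeasure (count_space UNIV) ?B = ennreal (card ?B)"
      using fin by (simp add: ennreal_of_nat_eq_real_of_nat)
    have "ennreal (1 / (2 * L) ^ CARD('d) * card ?B) < ennreal K"
      using * unfolding e by (subst ennreal_mult) (use pos in auto)
    then have "1 / (2 * L) ^ CARD('d) * card ?B < K"
      by (subst (asm) ennreal_less_iff) (use L in auto)
    then have "card ?B < K * (2 * L) ^ CARD('d)"
      using L by (simp add: divide_less_eq)
    then show ?thesis using fin by (simp add: power_mult_distrib mult.assoc)
  qed
  show ?thesis
    by (rule that[of "K * 2 ^ CARD('d)" "max 1 L1"]) (use K * in auto)
qed

lemma uniformly_discrete_imp_finite_upper_uniform_density: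
  fixes S :: "(real ^ 'd) set"
  assumes "uniformly_discrete S"
  shows "upper_uniform_density S < \<infinity>"
proof -
  obtain r where r: "r > 0" "\<And>a b. a \<in> S \<Longrightarrow> b \<in> S \<Longrightarrow> infnorm (a - b) < r \<Longrightarrow> a = b"
    using assms unfolding uniformly_discrete_iff by blast
  have "upper_uniform_density S \<le> ennreal ((1 / r + 1) ^ CARD('d))"
    unfolding upper_uniform_density_def
  proof (rule Limsup_bounded)
    show "\<forall>\<^sub>F L in at_top. (SUP x. ennreal (1 / (2 * L) ^ CARD('d))
      * emeasure (count_space UNIV) {a \<in> S. infnorm (a - x) < L}) \<le> ennreal ((1 / r + 1) ^ CARD('d))"
      using eventually_ge_at_top[of "1::real"]
    proof eventually_elim
      case (elim L)
      show ?case
      proof (rule SUP_least)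
        fix x :: "real ^ 'd"
        let ?B = "{a \<in> S. infnorm (a - x) < L}"
        have L: "L > 0" using elim by simp
        note B = uniformly_discrete_card_ball[where L = L and x = x, OF r]
        have "1 / (2 * L) ^ CARD('d) * card ?B \<le> 1 / (2 * L) ^ CARD('d) * (2 * L / r + 2) ^ CARD('d)"
          using B(2) L by (intro mult_left_mono) auto
        also have "\<dots> = ((2 * L / r + 2) / (2 * L)) ^ CARD('d)" by (simp add: power_divide)
        also have "(2 * L / r + 2) / (2 * L) = 1 / r + 1 / L" using L r(1) by (simp add: field_simps)
        also have "(1 / r + 1 / L) ^ CARD('d) \<le> (1 / r + 1) ^ CARD('d)"
          using elim r(1) by (intro power_mono) auto
        finally have "1 / (2 * L) ^ CARD('d) * card ?B \<le> (1 / r + 1) ^ CARD('d)" .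
        moreover have "emeasure (count_space UNIV) ?B = ennreal (card ?B)"
          using B(1) L by (simp add: ennreal_of_nat_eq_real_of_nat)
        ultimately show "ennreal (1 / (2 * L) ^ CARD('d)) * emeasure (count_space UNIV) ?B
            \<le> ennreal ((1 / r + 1) ^ CARD('d))"
          using L by (simp add: ennreal_mult[symmetric] ennreal_leI)
      qed
    qed
  qed
  then show ?thesis by (rule le_less_trans) simp
qed

section \<open>From finite density to finiteness on balls\<close>

lemma relatively_dense_obtain:
  assumes "relatively_dense A"
  obtains R p where "R > 0" "\<And>x. p x \<in> A" "\<And>x. infnorm (p x - x) \<le> R"
proof -
  obtain R where "R > 0" "\<forall>x. \<exists>a\<in>A. infnorm (a - x) \<le> R"
    using assms unfolding relatively_dense_def by blast
  then show ?thesis using that by metis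
qed

text \<open>
  The points of the grid \<open>3 R \<nat>\<^sup>d\<close> are \<open>3 R\<close> apart, so points of \<open>A\<close> chosen within \<open>R\<close> of them are
  distinct.
\<close>

lemma relatively_dense_card_ball:
  fixes A :: "(real ^ 'd) set"
  assumes R: "R > 0" and p: "\<And>x. p x \<in> A" "\<And>x. infnorm (p x - x) \<le> R"
    and fin: "finite {a \<in> A. infnorm a < 5 * R * real m}" and m: "m > 0"
  shows "m ^ CARD('d) \<le> card {a \<in> A. infnorm a < 5 * R * real m}"
proof -
  define I where "I = (UNIV :: 'd set) \<rightarrow>\<^sub>E {..<m}"
  define q :: "('d \<Rightarrow> nat) \<Rightarrow> real ^ 'd" where "q g = (\<chi> i. 3 * R * real (g i))" for g
  have c: "card I = m ^ CARD('d)" by (simp add: I_def card_PiE)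
  have "inj_on (\<lambda>g. p (q g)) I"
  proof (rule inj_onI)
    fix g h assume "p (q g) = p (q h)"
    then have "infnorm (q g - q h) \<le> infnorm (q g - p (q g)) + infnorm (p (q h) - q h)"
      using infnorm_triangle[of "q g - p (q g)" "p (q h) - q h"] by simp
    also have "\<dots> \<le> R + R" using p(2)[of "q g"] p(2)[of "q h"] 
      by (intro add_mono) (simp_all add: infnorm_sub)
    finally have *: "infnorm (q g - q h) \<le> 2 * R" by simp
    show "g = h"
    proof
      fix i
      have "\<bar>3 * R * real (g i) - 3 * R * real (h i)\<bar> \<le> 2 * R"
        using order_trans[OF component_le_infnorm_cart *, of i] by (simp add: q_def)
      also have "3 * R * real (g i) - 3 * R * real (h i) = (3 * R) * (real (g i) - real (h i))"
        by (simp add: algebra_simps)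
      finally have "3 * R * \<bar>real (g i) - real (h i)\<bar> \<le> 2 * R" using R by (simp add: abs_mult)
      also have "\<dots> < 3 * R * 1" using R by simp
      finally have "\<bar>real (g i) - real (h i)\<bar> < 1" using R by simp
      then show "g i = h i" by linarith
    qed
  qed
  moreover have "(\<lambda>g. p (q g)) ` I \<subseteq> {a \<in> A. infnorm a < 5 * R * real m}"
  proof clarify
    fix g assume g: "g \<in> I"
    have "infnorm (q g) \<le> 3 * R * real m" unfolding infnorm_le_iff
    proof
      fix i have "g i < m" using g by (auto simp: I_def)
      then show "\<bar>q g $ i\<bar> \<le> 3 * R * real m" using R by (simp add: q_def)
    qed
    moreover have "infnorm (p (q g)) \<le> infnorm (p (q g) - q g) + infnorm (q g)"
      using infnorm_triangle[of "p (q g) - q g" "q g"] by simp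
    moreover have "R \<le> R * real m" using R m by simp
    ultimately have "infnorm (p (q g)) < 5 * R * real m"
      using p(2)[of "q g"] R unfolding mult.assoc by linarith
    then show "p (q g) \<in> A \<and> infnorm (p (q g)) < 5 * R * real m" using p(1) by simp
  qed
  ultimately have "card I \<le> card {a \<in> A. infnorm a < 5 * R * real m}"
    using fin by (rule card_inj_on_le)
  then show ?thesis by (simp add: c)
qed

text \<open>
  The set \<open>B\<close> is the part of \<open>A\<close> in a large ball. Its size and the size of \<open>B - B\<close> both have the
  order of the volume of the ball, so \<open>K\<close> does not depend on the radius.
\<close>

lemma finite_density_difference_imp_small_difference:
  fixes A :: "(real ^ 'd) set"
  assumes dense: "relatively_dense A"
    and dens: "upper_uniform_density (difference_set A A) < \<infinity>"
  obtains K :: real where "\<And>n. \<exists>B. finite B \<and> B \<noteq> {} \<and> {a \<in> A. infnorm a \<le> n} \<subseteq> B \<and> B \<subseteq> A \<and>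
    card (difference_set B B) \<le> K * card B"
proof -
  define D where "D = difference_set A A"
  obtain R p where R: "R > 0" and p: "\<And>x. p x \<in> A" "\<And>x. infnorm (p x - x) \<le> R"
    by (rule relatively_dense_obtain[OF dense]) (rule that)
  obtain K L0 :: real where K: "K \<ge> 0" "L0 > 0" 
    and fin: "\<And>L x. L \<ge> L0 \<Longrightarrow> finite {a \<in> D. infnorm (a - x) < L}"
    and card: "\<And>L x. L \<ge> L0 \<Longrightarrow> card {a \<in> D. infnorm (a - x) < L} \<le> K * L ^ CARD('d)"
    by (rule finite_upper_uniform_densityD[OF dens, folded D_def]) (rule that)
  show ?thesis
  proof (rule that[of "K * (10 * R) ^ CARD('d)"])
    fix n
    \<comment> \<open>The radius \<open>5 R m\<close> of the ball that defines \<open>B\<close> must exceed both \<open>n\<close> and \<open>L0\<close>.\<close>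
    obtain m0 where m0: "real m0 > max n L0 / (5 * R)" using reals_Archimedean2 by blast
    define m where "m = max 1 m0"
    have m: "m > 0" "real m > max n L0 / (5 * R)" using m0 by (auto simp: m_def)
    have mL: "max n L0 < 5 * R * real m" using m(2) R by (simp add: divide_less_eq mult.commute)
    define B where "B = {a \<in> A. infnorm a < 5 * R * real m}"
    have "B \<subseteq> (\<lambda>x. x + p 0) ` {a \<in> D. infnorm (a - (- p 0)) < 5 * R * real m}"
    proof
      fix a assume "a \<in> B"
      then have "a - p 0 \<in> {a \<in> D. infnorm (a - (- p 0)) < 5 * R * real m}"
        using p(1) by (auto simp: B_def D_def intro: difference_setI)
      then show "a \<in> (\<lambda>x. x + p 0) ` {a \<in> D. infnorm (a - (- p 0)) < 5 * R * real m}"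
        by (intro image_eqI[of _ _ "a - p 0"]) auto
    qed
    then have fB: "finite B" 
      by (rule finite_subset) (intro finite_imageI fin, use mL in linarith)
    have cB: "m ^ CARD('d) \<le> card B"
      unfolding B_def by (rule relatively_dense_card_ball[OF R p fB[unfolded B_def] m(1)])
    have "difference_set B B \<subseteq> {x \<in> D. infnorm (x - 0) < 10 * R * real m}"
    proof
      fix x assume "x \<in> difference_set B B"
      then obtain a b where x: "a \<in> B" "b \<in> B" "x = a - b" by (rule difference_setE)
      have "infnorm (a - b) \<le> infnorm a + infnorm b"
        using infnorm_triangle[of a "- b"] by (simp add: infnorm_neg)
      then show "x \<in> {x \<in> D. infnorm (x - 0) < 10 * R * real m}"
        using x by (auto simp: B_def D_def intro: difference_setI)
    qed
    moreover have L: "L0 \<le> 10 * R * real m" using mL K by linarith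
    ultimately have "card (difference_set B B) \<le> card {x \<in> D. infnorm (x - 0) < 10 * R * real m}"
      by (intro card_mono fin)
    also have "real \<dots> \<le> K * (10 * R * real m) ^ CARD('d)" by (rule card[OF L])
    also have "\<dots> = K * (10 * R) ^ CARD('d) * real (m ^ CARD('d))" by (simp add: power_mult_distrib)
    also have "\<dots> \<le> K * (10 * R) ^ CARD('d) * card B"
      using cB K R by (intro mult_left_mono of_nat_mono) auto
    finally have small: "card (difference_set B B) \<le> K * (10 * R) ^ CARD('d) * card B" by simp
    have "card B > 0" using cB m by (metis gr0I le_zero_eq power_not_zero less_irrefl)
    then have "B \<noteq> {}" by auto
    moreover have "{a \<in> A. infnorm a \<le> n} \<subseteq> B" using mL by (auto simp: B_def)
    ultimately show "\<exists>B. finite B \<and> B \<noteq> {} \<and> {a \<in> A. infnorm a \<le> n} \<subseteq> B \<and> B \<subseteq> A \<and>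
        card (difference_set B B) \<le> K * (10 * R) ^ CARD('d) * card B"
      using fB small by (intro exI[of _ B]) (auto simp: B_def)
  qed
qed

text \<open>
  The cardinalities of the finite subsets \<open>S\<close> of \<open>D - D\<close> in a fixed ball are bounded: \<open>S\<close> comes
  from a finite part \<open>B\<close> of \<open>A\<close> of small difference constant, so boundedly many translates of \<open>D\<close>
  cover it, and each contributes boundedly many points by the density of \<open>D\<close>.
\<close>

lemma finite_density_difference_imp_finite_on_balls:
  fixes A :: "(real ^ 'd) set"
  assumes dense: "relatively_dense A"
    and dens: "upper_uniform_density (difference_set A A) < \<infinity>"
  shows "finite_on_balls (difference_set (difference_set A A) (difference_set A A))"
  unfolding finite_on_balls_def
proof
  fix \<rho>
  define D where "D = difference_set A A"
  \<comment> \<open>\<open>E n\<close> is the part of \<open>D - D\<close> that is generated by the points of \<open>A\<close> of norm at most \<open>n\<close>.\<close>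
  define E where "E n = (let A' = {a \<in> A. infnorm a \<le> n}; D' = difference_set A' A' in difference_set D' D')" for n
  obtain C :: real where C: "\<And>n. \<exists>B. finite B \<and> B \<noteq> {} \<and> {a \<in> A. infnorm a \<le> n} \<subseteq> B \<and> B \<subseteq> A \<and>
    card (difference_set B B) \<le> C * card B"
    using finite_density_difference_imp_small_difference[OF assms] by blast
  obtain K L0 :: real where K: "K \<ge> 0" "L0 > 0" 
    and fin: "\<And>L x. L \<ge> L0 \<Longrightarrow> finite {a \<in> D. infnorm (a - x) < L}"
    and card: "\<And>L x. L \<ge> L0 \<Longrightarrow> card {a \<in> D. infnorm (a - x) < L} \<le> K * L ^ CARD('d)"
    by (rule finite_upper_uniform_densityD[OF dens, folded D_def]) (rule that)
  define L where "L = max L0 (\<rho> + 1)"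
  define N where "N = K * L ^ CARD('d)"
  have L: "L \<ge> L0" "\<rho> < L" by (auto simp: L_def)
  have E_mono: "E n \<subseteq> E n'" if "n \<le> n'" for n n'
    unfolding E_def Let_def using that by (intro difference_set_mono) auto
  have ex_E: "\<exists>n. x \<in> E n" if x: "x \<in> difference_set D D" for x
  proof -
    obtain a b c d where x: "a \<in> A" "b \<in> A" "c \<in> A" "d \<in> A" "x = (a - b) - (c - d)"
      by (rule difference_set_twiceE[OF x[unfolded D_def]])
    define n where "n = Max {infnorm a, infnorm b, infnorm c, infnorm d}"
    have "x \<in> E n" unfolding x(5) E_def Let_def
      by (intro difference_setI CollectI conjI x) (auto simp: n_def)
    then show ?thesis ..
  qed
  have bound: "card S \<le> C ^ 5 * N" if S: "S \<subseteq> {x \<in> difference_set D D. infnorm x \<le> \<rho>}" "finite S" for S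
  proof -
    obtain f where f: "\<And>x. x \<in> S \<Longrightarrow> x \<in> E (f x)"
      using ex_E S(1) by (metis (no_types, lifting) mem_Collect_eq subset_iff)
    define n where "n = Max (insert 0 (f ` S))"
    have "f x \<le> n" if "x \<in> S" for x unfolding n_def using S(2) that by (intro Max_ge) auto
    then have SE: "S \<subseteq> E n" using f E_mono by blast
    obtain B where B: "finite B" "B \<noteq> {}" "{a \<in> A. infnorm a \<le> n} \<subseteq> B" "B \<subseteq> A"
      "card (difference_set B B) \<le> C * card B" using C by blast
    obtain T where T: "T \<subseteq> difference_set (difference_set B B) (difference_set B B)"
      "difference_set (difference_set B B) (difference_set B B) \<subseteq> T + difference_set B B"
      "card T \<le> C ^ 5"
      using small_difference_iterated[OF B(1,2,5)] by metis
    have fT: "finite T"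
      by (rule finite_subset[OF T(1)]) (use B(1) in \<open>simp add: difference_set_eq_plus finite_set_plus\<close>)
    let ?Q = "\<lambda>t. {y \<in> D. infnorm (y - (- t)) < L}"
    have "S \<subseteq> (\<Union>t\<in>T. (+) t ` ?Q t)"
    proof
      fix x assume x: "x \<in> S"
      have "E n \<subseteq> difference_set (difference_set B B) (difference_set B B)"
        unfolding E_def Let_def by (intro difference_set_mono B(3))
      then have "x \<in> T + difference_set B B" using x SE T(2) by blast
      then obtain t y where t: "t \<in> T" "y \<in> difference_set B B" "x = t + y" by (rule set_plus_elim)
      have "y \<in> D" using t(2) difference_set_mono[OF B(4) B(4)] by (auto simp: D_def)
      moreover have "infnorm (y - (- t)) < L" using S(1) x t(3) L(2) by (auto simp: add.commute)
      ultimately show "x \<in> (\<Union>t\<in>T. (+) t ` ?Q t)" using t by auto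
    qed
    then have "card S \<le> card (\<Union>t\<in>T. (+) t ` ?Q t)"
      using fT fin[OF L(1)] by (intro card_mono finite_UN_I finite_imageI)
    also have "\<dots> \<le> (\<Sum>t\<in>T. card ((+) t ` ?Q t))" by (rule card_UN_le[OF fT])
    finally have "real (card S) \<le> (\<Sum>t\<in>T. real (card ((+) t ` ?Q t)))"
      by (simp only: of_nat_sum[symmetric] of_nat_le_iff)
    also have "\<dots> \<le> (\<Sum>t\<in>T. N)"
    proof (rule sum_mono)
      fix t show "card ((+) t ` ?Q t) \<le> N"
        using card[OF L(1), of "- t"] by (simp add: card_image N_def)
    qed
    also have "\<dots> = card T * N" by simp
    also have "\<dots> \<le> C ^ 5 * N" using T(3) K L by (intro mult_right_mono) (auto simp: N_def)
    finally show ?thesis .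
  qed
  have "finite {x \<in> difference_set D D. infnorm x \<le> \<rho>}"
  proof (rule finite_if_finite_subsets_card_bdd[THEN conjunct1])
    fix S assume "S \<subseteq> {x \<in> difference_set D D. infnorm x \<le> \<rho>}" "finite S"
    then show "card S \<le> nat \<lfloor>C ^ 5 * N\<rfloor>" using bound[of S] by linarith
  qed
  then show "finite {x \<in> difference_set (difference_set A A) (difference_set A A). infnorm x \<le> \<rho>}"
    by (simp add: D_def)
qed

section \<open>Difference sets covered by finitely many translates\<close>

text \<open>
  Translating by a point of \<open>A\<close> embeds \<open>A - A - A\<close> into \<open>(A - A) - (A - A)\<close>.
\<close>

lemma finite_on_balls_triple_difference:
  assumes E: "finite_on_balls (difference_set (difference_set A A) (difference_set A A))"
  shows "finite_on_balls (difference_set (difference_set A A) A)"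
proof (cases "A = {}")
  case False
  then obtain a0 where a0: "a0 \<in> A" by auto
  have "difference_set (difference_set A A) A
      \<subseteq> difference_set (difference_set A A) (difference_set A A) + {- a0}"
  proof
    fix x assume "x \<in> difference_set (difference_set A A) A"
    then obtain u c where x: "u \<in> difference_set A A" "c \<in> A" "x = u - c" by (rule difference_setE)
    have "(u - (c - a0)) + (- a0)
        \<in> difference_set (difference_set A A) (difference_set A A) + {- a0}"
      using x a0 by (intro set_plus_intro difference_setI) auto
    then show "x \<in> difference_set (difference_set A A) (difference_set A A) + {- a0}"
      using x(3) by simp
  qed
  then show ?thesis
    by (rule finite_on_balls_subset[rotated]) (intro finite_on_balls_plus_finite E, simp)
qed (simp add: finite_on_balls_def difference_set_def)

lemma difference_set_subset_plus_finite:
  assumes dense: "relatively_dense A"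
    and E: "finite_on_balls (difference_set (difference_set A A) (difference_set A A))"
  shows "\<exists>F. finite F \<and> difference_set A A \<subseteq> A + F"
proof -
  obtain R p where "R > 0" and p: "\<And>x. p x \<in> A" "\<And>x. infnorm (p x - x) \<le> R"
    by (rule relatively_dense_obtain[OF dense]) (rule that)
  define F where "F = {x \<in> difference_set (difference_set A A) A. infnorm x \<le> R}"
  have "finite F" unfolding F_def by (intro finite_on_ballsD finite_on_balls_triple_difference E)
  moreover have "difference_set A A \<subseteq> A + F"
  proof
    fix x assume "x \<in> difference_set A A"
    then have "x - p x \<in> F" using p by (auto simp: F_def infnorm_sub intro: difference_setI)
    then have "p x + (x - p x) \<in> A + F" by (intro set_plus_intro p(1))
    then show "x \<in> A + F" by simp
  qed
  ultimately show ?thesis by blast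
qed

text \<open>
  Applying the inclusion three times gives \<open>(a + f) - (b + g) = (a - b) + (f - g) = c + h + (f - g)\<close>.
\<close>

lemma difference_set_subset_plus_finite_imp_finite_on_balls:
  assumes A: "uniformly_discrete A" and F: "finite F" and sub: "difference_set A A \<subseteq> A + F"
  shows "finite_on_balls (difference_set (difference_set A A) (difference_set A A))"
proof (rule finite_on_balls_subset)
  show "finite_on_balls (A + (F + difference_set F F))"
    using F by (intro finite_on_balls_plus_finite uniformly_discrete_imp_finite_on_balls[OF A])
      (simp add: finite_set_plus difference_set_eq_plus)
  show "difference_set (difference_set A A) (difference_set A A) \<subseteq> A + (F + difference_set F F)"
  proof
    fix x assume "x \<in> difference_set (difference_set A A) (difference_set A A)"
    then obtain u v where x: "u \<in> difference_set A A" "v \<in> difference_set A A" "x = u - v"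
      by (rule difference_setE)
    obtain a f where u: "a \<in> A" "f \<in> F" "u = a + f"
      by (rule set_plus_elim[OF subsetD[OF sub x(1)]])
    obtain b g where v: "b \<in> A" "g \<in> F" "v = b + g"
      by (rule set_plus_elim[OF subsetD[OF sub x(2)]])
    have "a - b \<in> A + F" using u v sub by (auto intro: difference_setI)
    then obtain c h where c: "c \<in> A" "h \<in> F" "a - b = c + h" by (rule set_plus_elim)
    have "c + (h + (f - g)) \<in> A + (F + difference_set F F)"
      using c u v by (intro set_plus_intro difference_setI)
    moreover have "x = c + (h + (f - g))" using c u v x by (simp add: algebra_simps)
    ultimately show "x \<in> A + (F + difference_set F F)" by simp
  qed
qed

section \<open>Discrete subgroups and cut-and-project sets\<close>

text \<open>
  The neighbourhood of \<open>0\<close> that isolates it in \<open>\<Gamma>\<close> may be taken to be a cube, because a basic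
  open set of the product topology restricts each coordinate to an open set.
\<close>

lemma discrete_subgroup_isolated:
  fixes \<Gamma> :: "((real ^ 'd) \<times> (nat \<Rightarrow> real)) set"
  assumes "discrete_subgroup e \<Gamma>"
  obtains r where "r > 0"
    "\<And>g. g \<in> \<Gamma> \<Longrightarrow> infnorm (fst g) < r \<Longrightarrow> \<forall>i<e. \<bar>snd g i\<bar> < r \<Longrightarrow> g = 0"
proof -
  let ?T = "prod_topology euclidean (Euclidean_space e) :: ((real ^ 'd) \<times> (nat \<Rightarrow> real)) topology"
  have "0 \<in> \<Gamma>" and disc: "subtopology ?T \<Gamma> = discrete_topology \<Gamma>"
    and top: "\<Gamma> \<subseteq> UNIV \<times> topspace (Euclidean_space e)"
    using assms by (auto simp: discrete_subgroup_def)
  have "openin (subtopology ?T \<Gamma>) {0}" unfolding disc using \<open>0 \<in> \<Gamma>\<close> by simp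
  then obtain T where T: "openin ?T T" "{0} = T \<inter> \<Gamma>" by (auto simp: openin_subtopology)
  have "(0, 0) \<in> T" using T(2) by (auto simp: zero_prod_def)
  have alt: "\<And>x y. (x, y) \<in> T \<Longrightarrow> \<exists>U V. openin euclidean U \<and> openin (Euclidean_space e) V \<and>
      x \<in> U \<and> y \<in> V \<and> U \<times> V \<subseteq> T"
    using T(1) unfolding openin_prod_topology_alt by iprover
  obtain U V where U: "open U" "0 \<in> U" and V: "openin (Euclidean_space e) V" "0 \<in> V"
    and UV: "U \<times> V \<subseteq> T"
    using alt[OF \<open>(0, 0) \<in> T\<close>] unfolding open_openin[symmetric] by blast
  obtain \<delta> where \<delta>: "\<delta> > 0" "ball 0 \<delta> \<subseteq> U" using U open_contains_ball by blast
  obtain W where W: "openin (powertop_real UNIV) W" "V = W \<inter> {x. \<forall>i\<ge>e. x i = 0}"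
    using V(1) by (auto simp: Euclidean_space_def openin_subtopology)
  have "0 \<in> W" using V(2) W(2) by auto
  from product_topology_open_contains_basis[OF W(1) this]
  obtain X where X: "0 \<in> (\<Pi>\<^sub>E i\<in>UNIV. X i)" "\<And>i. open (X i)" "(\<Pi>\<^sub>E i\<in>UNIV. X i) \<subseteq> W"
    by auto
  have "\<forall>i. \<exists>s>0. ball 0 s \<subseteq> X i"
  proof
    fix i have "0 \<in> X i" using X(1) by (auto simp: PiE_iff)
    then show "\<exists>s>0. ball 0 s \<subseteq> X i" using X(2) open_contains_ball by blast
  qed
  then obtain s where s: "\<And>i. s i > 0" "\<And>i. ball 0 (s i) \<subseteq> X i" by metis
  define c where "c = sqrt (real DIM(real ^ 'd))"
  have c: "c > 0" by (simp add: c_def)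
  define r where "r = Min (insert (\<delta> / c) (s ` {..<e}))"
  have "r > 0" using s \<delta> c by (simp add: r_def)
  have r: "r \<le> \<delta> / c" "\<And>i. i < e \<Longrightarrow> r \<le> s i" unfolding r_def by (auto intro!: Min_le)
  show ?thesis
  proof (rule that[OF \<open>r > 0\<close>])
    fix g assume g: "g \<in> \<Gamma>" and 1: "infnorm (fst g) < r" and 2: "\<forall>i<e. \<bar>snd g i\<bar> < r"
    have "norm (fst g) \<le> c * infnorm (fst g)" unfolding c_def by (rule norm_le_infnorm)
    also have "\<dots> < c * (\<delta> / c)" using 1 r c by (intro mult_strict_left_mono) auto
    finally have "fst g \<in> U" using \<delta>(2) c by auto
    moreover have out: "snd g i = 0" if "i \<ge> e" for i
      using g top that by (auto simp: topspace_Euclidean_space)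
    have "snd g i \<in> X i" for i
    proof (cases "i < e")
      case True
      then have "\<bar>snd g i\<bar> < s i" using 2 r(2) by force
      then show ?thesis using s(2)[of i] by (auto simp: dist_norm)
    next
      case False
      then show ?thesis using out X(1) by (auto simp: PiE_iff)
    qed
    then have "snd g \<in> V" using W(2) X(3) out by (auto simp: PiE_iff)
    ultimately have "g \<in> T" using UV by (auto simp: mem_Times_iff)
    then show "g = 0" using T(2) g by auto
  qed
qed

lemma discrete_subgroup_diff:
  "discrete_subgroup e \<Gamma> \<Longrightarrow> g \<in> \<Gamma> \<Longrightarrow> h \<in> \<Gamma> \<Longrightarrow> g - h \<in> \<Gamma>"
  unfolding discrete_subgroup_def by (metis diff_conv_add_uminus)

text \<open>
  By translation, isolation at \<open>0\<close> separates all points of \<open>\<Gamma>\<close> by the same \<open>r\<close>. The grid count is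
  used with the \<open>d + e\<close> coordinates indexed by a sum type.
\<close>

lemma discrete_subgroup_finite_box:
  fixes \<Gamma> :: "((real ^ 'd) \<times> (nat \<Rightarrow> real)) set"
  assumes \<Gamma>: "discrete_subgroup e \<Gamma>"
  shows "finite {g \<in> \<Gamma>. infnorm (fst g) \<le> \<rho> \<and> (\<forall>i<e. \<bar>snd g i\<bar> \<le> B)}"
proof -
  let ?S = "{g \<in> \<Gamma>. infnorm (fst g) \<le> \<rho> \<and> (\<forall>i<e. \<bar>snd g i\<bar> \<le> B)}"
  let ?I = "range Inl \<union> Inr ` {..<e} :: ('d + nat) set"
  define f :: "'d + nat \<Rightarrow> (real ^ 'd) \<times> (nat \<Rightarrow> real) \<Rightarrow> real"
    where "f = case_sum (\<lambda>i g. fst g $ i) (\<lambda>i g. snd g i)"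
  obtain r where r: "r > 0"
    "\<And>g. g \<in> \<Gamma> \<Longrightarrow> infnorm (fst g) < r \<Longrightarrow> \<forall>i<e. \<bar>snd g i\<bar> < r \<Longrightarrow> g = 0"
    by (rule discrete_subgroup_isolated[OF \<Gamma>]) (rule that)
  show ?thesis
  proof (rule separated_finite_card(1)[of ?I r "max 0 (max \<rho> B)" ?S f])
    fix g i assume "g \<in> ?S" "i \<in> ?I"
    then show "\<bar>f i g\<bar> \<le> max 0 (max \<rho> B)"
      by (auto simp: f_def infnorm_le_iff le_max_iff_disj)
  next
    fix g h assume g: "g \<in> ?S" "h \<in> ?S" and close: "\<And>i. i \<in> ?I \<Longrightarrow> \<bar>f i g - f i h\<bar> < r"
    have "g - h = 0"
    proof (rule r(2))
      show "g - h \<in> \<Gamma>" using \<Gamma> g by (auto intro: discrete_subgroup_diff)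
      show "infnorm (fst (g - h)) < r" unfolding infnorm_less_iff
      proof
        fix i show "\<bar>fst (g - h) $ i\<bar> < r" using close[of "Inl i"] by (simp add: f_def)
      qed
      show "\<forall>i<e. \<bar>snd (g - h) i\<bar> < r"
      proof (intro allI impI)
        fix i assume "i < e"
        then show "\<bar>snd (g - h) i\<bar> < r" using close[of "Inr i"] by (simp add: f_def)
      qed
    qed
    then show "g = h" by simp
  qed (use r in auto)
qed

text \<open>
  A point of \<open>(A - A) - (A - A)\<close> is, up to the finite set \<open>(F - F) - (F - F)\<close>, the first component
  of a combination of four elements of \<open>\<Gamma>\<close>, whose second component is at most four times the
  bound of the window.
\<close>

lemma cut_and_project_imp_finite_on_balls:
  assumes M: "cut_and_project M" and F: "finite F" and sub: "A \<subseteq> M + F"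
  shows "finite_on_balls (difference_set (difference_set A A) (difference_set A A))"
proof -
  obtain e \<Gamma> \<Omega> where \<Gamma>: "discrete_subgroup e \<Gamma>" and \<Omega>: "bounded_Euclidean e \<Omega>"
    and M_eq: "M = fst ` (\<Gamma> \<inter> (UNIV \<times> \<Omega>))"
    using M unfolding cut_and_project_def by blast
  obtain B where B: "\<And>y i. y \<in> \<Omega> \<Longrightarrow> i < e \<Longrightarrow> \<bar>y i\<bar> \<le> B"
    using \<Omega> unfolding bounded_Euclidean_def by blast
  define P where "P = fst ` {g \<in> \<Gamma>. \<forall>i<e. \<bar>snd g i\<bar> \<le> 4 * B}"
  have "finite {x \<in> P. infnorm x \<le> \<rho>}" for \<rho>
  proof -
    have "{x \<in> P. infnorm x \<le> \<rho>}
        \<subseteq> fst ` {g \<in> \<Gamma>. infnorm (fst g) \<le> \<rho> \<and> (\<forall>i<e. \<bar>snd g i\<bar> \<le> 4 * B)}"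
      unfolding P_def by auto
    then show ?thesis
      by (rule finite_subset[OF _ finite_imageI[OF discrete_subgroup_finite_box[OF \<Gamma>]]])
  qed
  then have P: "finite_on_balls P" by (simp add: finite_on_balls_def)
  define F' where "F' = difference_set (difference_set F F) (difference_set F F)"
  have F': "finite F'" using F by (simp add: F'_def difference_set_eq_plus finite_set_plus)
  have lift: "\<exists>g f. g \<in> \<Gamma> \<and> snd g \<in> \<Omega> \<and> f \<in> F \<and> a = fst g + f" if "a \<in> A" for a
  proof -
    have "a \<in> M + F" using that sub by blast
    then obtain m f where "m \<in> M" "f \<in> F" "a = m + f" by (rule set_plus_elim)
    moreover from \<open>m \<in> M\<close> obtain g where "g \<in> \<Gamma>" "snd g \<in> \<Omega>" "m = fst g"
      unfolding M_eq by auto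
    ultimately show ?thesis by blast
  qed
  have "difference_set (difference_set A A) (difference_set A A) \<subseteq> P + F'"
  proof
    fix x assume "x \<in> difference_set (difference_set A A) (difference_set A A)"
    then obtain a1 a2 a3 a4 where a: "a1 \<in> A" "a2 \<in> A" "a3 \<in> A" "a4 \<in> A" "x = (a1 - a2) - (a3 - a4)"
      by (rule difference_set_twiceE)
    obtain g1 f1 where 1: "g1 \<in> \<Gamma>" "snd g1 \<in> \<Omega>" "f1 \<in> F" "a1 = fst g1 + f1" using lift a by blast
    obtain g2 f2 where 2: "g2 \<in> \<Gamma>" "snd g2 \<in> \<Omega>" "f2 \<in> F" "a2 = fst g2 + f2" using lift a by blast
    obtain g3 f3 where 3: "g3 \<in> \<Gamma>" "snd g3 \<in> \<Omega>" "f3 \<in> F" "a3 = fst g3 + f3" using lift a by blast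
    obtain g4 f4 where 4: "g4 \<in> \<Gamma>" "snd g4 \<in> \<Omega>" "f4 \<in> F" "a4 = fst g4 + f4" using lift a by blast
    define g where "g = (g1 - g2) - (g3 - g4)"
    have "g \<in> \<Gamma>" unfolding g_def using 1 2 3 4 by (intro discrete_subgroup_diff[OF \<Gamma>])
    moreover have "\<bar>snd g i\<bar> \<le> 4 * B" if "i < e" for i
      using B[OF 1(2) that] B[OF 2(2) that] B[OF 3(2) that] B[OF 4(2) that] by (simp add: g_def)
    ultimately have "fst g \<in> P" unfolding P_def by blast
    moreover have "(f1 - f2) - (f3 - f4) \<in> F'"
      unfolding F'_def using 1 2 3 4 by (intro difference_setI)
    ultimately have "fst g + ((f1 - f2) - (f3 - f4)) \<in> P + F'" by (rule set_plus_intro)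
    moreover have "x = fst g + ((f1 - f2) - (f3 - f4))"
      using 1(4) 2(4) 3(4) 4(4) a(5) by (simp add: g_def algebra_simps)
    ultimately show "x \<in> P + F'" by simp
  qed
  then show ?thesis by (rule finite_on_balls_subset[rotated]) (rule finite_on_balls_plus_finite[OF P F'])
qed

section \<open>Almost additive functions\<close>

text \<open>
  The increments sum to at most \<open>C\<close>. This is the analytic content of Hyers's theorem below.
\<close>

lemma sequence_limit_of_geometric_increments:
  fixes X :: "nat \<Rightarrow> real"
  assumes step: "\<And>n. \<bar>X (Suc n) - X n\<bar> \<le> C / 2 ^ Suc n"
  obtains l where "X \<longlonglongrightarrow> l" "\<bar>X 0 - l\<bar> \<le> C"
proof -
  have geo: "(\<lambda>n. C / 2 ^ Suc n) sums C"
    using sums_mult[OF power_half_series, of C] by (simp add: power_divide)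
  have s: "summable (\<lambda>n. \<bar>X (Suc n) - X n\<bar>)"
    by (rule summable_comparison_test'[OF sums_summable[OF geo], of 0]) (use step in auto)
  define l where "l = X 0 + (\<Sum>n. X (Suc n) - X n)"
  have "(\<lambda>n. X 0 + (\<Sum>k<n. X (Suc k) - X k)) \<longlonglongrightarrow> l"
    unfolding l_def by (intro tendsto_intros summable_LIMSEQ summable_rabs_cancel[OF s])
  then have lim: "X \<longlonglongrightarrow> l" by (simp add: sum_lessThan_telescope)
  have "\<bar>X 0 - l\<bar> = \<bar>\<Sum>n. X (Suc n) - X n\<bar>" by (simp add: l_def)
  also have "\<dots> \<le> (\<Sum>n. \<bar>X (Suc n) - X n\<bar>)" by (rule summable_rabs[OF s])
  also have "\<dots> \<le> (\<Sum>n. C / 2 ^ Suc n)" by (rule suminf_le[OF step s sums_summable[OF geo]])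
  also have "\<dots> = C" by (rule sums_unique[OF geo, symmetric])
  finally show ?thesis using that lim by blast
qed

text \<open>
  The defect \<open>D t = l (t v) - t l v\<close> is additive in \<open>t\<close> and vanishes at \<open>1\<close>. So it has period
  \<open>1\<close> and is bounded, and a bounded additive function is zero.
\<close>

lemma additive_locally_bounded_imp_linear:
  fixes l :: "'a::real_vector \<Rightarrow> real"
  assumes add: "\<And>u v. l (u + v) = l u + l v"
    and bdd: "\<And>v. \<exists>M. \<forall>t\<in>{0..1}. \<bar>l (t *\<^sub>R v)\<bar> \<le> M"
  shows "linear l"
proof (rule linearI[OF add])
  fix t v
  obtain M where M: "\<And>t. t \<in> {0..1} \<Longrightarrow> \<bar>l (t *\<^sub>R v)\<bar> \<le> M" using bdd by blast
  define D where "D t = l (t *\<^sub>R v) - t * l v" for t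
  have D_add: "D (s + t) = D s + D t" for s t by (simp add: D_def add scaleR_add_left algebra_simps)
  have D0: "D 0 = 0" using D_add[of 0 0] by simp
  have D_mult: "D (real n * t) = real n * D t" for n t
    by (induction n) (simp_all add: D0 D_add algebra_simps)
  have D1: "D 1 = 0" by (simp add: D_def)
  have bound: "\<bar>D t\<bar> \<le> M + \<bar>l v\<bar>" if "t \<ge> 0" for t
  proof -
    define n where "n = nat \<lfloor>t\<rfloor>"
    have n: "real n = of_int \<lfloor>t\<rfloor>" using that by (simp add: n_def)
    have "D t = D (frac t + real n * 1)" unfolding n by (simp add: frac_def)
    also have "\<dots> = D (frac t)" using D_mult[of n 1] by (simp only: D_add D1 mult_zero_right add_0_right)
    also have "\<bar>\<dots>\<bar> \<le> \<bar>l (frac t *\<^sub>R v)\<bar> + \<bar>frac t * l v\<bar>" unfolding D_def by linarith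
    also have "\<bar>frac t * l v\<bar> \<le> 1 * \<bar>l v\<bar>"
      unfolding abs_mult using frac_ge_0[of t] frac_lt_1[of t] by (intro mult_right_mono) auto
    also have "\<bar>l (frac t *\<^sub>R v)\<bar> \<le> M" using frac_ge_0[of t] frac_lt_1[of t] by (intro M) auto
    finally show ?thesis by simp
  qed
  have pos: "D t = 0" if "t \<ge> 0" for t
  proof (rule ccontr)
    assume "D t \<noteq> 0"
    obtain n where n: "real n > (M + \<bar>l v\<bar>) / \<bar>D t\<bar>" using reals_Archimedean2 by blast
    have "real n * \<bar>D t\<bar> = \<bar>D (real n * t)\<bar>" by (simp add: D_mult abs_mult)
    also have "\<dots> \<le> M + \<bar>l v\<bar>" using that by (intro bound) simp
    finally show False using n \<open>D t \<noteq> 0\<close> by (simp add: divide_less_eq)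
  qed
  have "D t = 0"
  proof (cases "t \<ge> 0")
    case False
    then have "D (- t) = 0" by (intro pos) simp
    then show ?thesis using D_add[of t "- t"] D0 by simp
  qed (rule pos)
  then show "l (t *\<^sub>R v) = t *\<^sub>R l v" by (simp add: D_def)
qed

text \<open>
  Hyers's theorem: \<open>l v\<close> is the limit of \<open>f (2\<^sup>n v) / 2\<^sup>n\<close>. Boundedness of \<open>f\<close> along segments passes
  to \<open>l\<close> and upgrades additivity to linearity.
\<close>

lemma quasi_additive_near_linear:
  fixes f :: "'a::real_vector \<Rightarrow> real"
  assumes qa: "\<And>u v. \<bar>f (u + v) - f u - f v\<bar> \<le> C"
    and bdd: "\<And>v. \<exists>M. \<forall>t\<in>{0..1}. \<bar>f (t *\<^sub>R v)\<bar> \<le> M"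
  obtains l where "linear l" "\<And>v. \<bar>f v - l v\<bar> \<le> C"
proof -
  define X where "X v n = f (2 ^ n *\<^sub>R v) / 2 ^ n" for v n
  have "\<exists>l. X v \<longlonglongrightarrow> l \<and> \<bar>f v - l\<bar> \<le> C" for v
  proof -
    have "\<bar>X v (Suc n) - X v n\<bar> \<le> C / 2 ^ Suc n" for n
    proof -
      let ?w = "2 ^ n *\<^sub>R v"
      have "2 ^ Suc n *\<^sub>R v = ?w + ?w" by (simp add: scaleR_add_left[symmetric])
      then have "X v (Suc n) - X v n = (f (?w + ?w) - f ?w - f ?w) / 2 ^ Suc n"
        by (simp add: X_def field_simps)
      then show ?thesis using qa[of ?w ?w] by (simp add: abs_divide divide_right_mono)
    qed
    then obtain l where "X v \<longlonglongrightarrow> l" "\<bar>X v 0 - l\<bar> \<le> C"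
      by (rule sequence_limit_of_geometric_increments)
    then show ?thesis by (auto simp: X_def)
  qed
  then obtain l where l: "\<And>v. X v \<longlonglongrightarrow> l v" "\<And>v. \<bar>f v - l v\<bar> \<le> C" by metis
  have add: "l (u + v) = l u + l v" for u v
  proof -
    have C: "(\<lambda>n. C / 2 ^ n) \<longlonglongrightarrow> 0"
      using tendsto_mult[OF tendsto_const[of C] LIMSEQ_divide_realpow_zero[of 2 1]] by simp
    have "(\<lambda>n. X (u + v) n - X u n - X v n) \<longlonglongrightarrow> 0"
    proof (rule Lim_null_comparison[OF _ C], rule always_eventually, rule allI)
      fix n
      have "X (u + v) n - X u n - X v n
          = (f (2 ^ n *\<^sub>R u + 2 ^ n *\<^sub>R v) - f (2 ^ n *\<^sub>R u) - f (2 ^ n *\<^sub>R v)) / 2 ^ n"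
        by (simp add: X_def scaleR_add_right diff_divide_distrib)
      then show "norm (X (u + v) n - X u n - X v n) \<le> C / 2 ^ n"
        using qa[of "2 ^ n *\<^sub>R u" "2 ^ n *\<^sub>R v"] by (simp add: abs_divide divide_right_mono)
    qed
    moreover have "(\<lambda>n. X (u + v) n - X u n - X v n) \<longlonglongrightarrow> l (u + v) - l u - l v"
      by (intro tendsto_intros l)
    ultimately have "l (u + v) - l u - l v = 0" by (rule LIMSEQ_unique[symmetric])
    then show ?thesis by simp
  qed
  have "linear l"
  proof (rule additive_locally_bounded_imp_linear[OF add])
    fix v
    obtain M where M: "\<And>t. t \<in> {0..1} \<Longrightarrow> \<bar>f (t *\<^sub>R v)\<bar> \<le> M" using bdd by blast
    have "\<bar>l (t *\<^sub>R v)\<bar> \<le> M + C" if "t \<in> {0..1}" for t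
      using M[OF that] l(2)[of "t *\<^sub>R v"] by linarith
    then show "\<exists>M. \<forall>t\<in>{0..1}. \<bar>l (t *\<^sub>R v)\<bar> \<le> M" by blast
  qed
  then show ?thesis using that l(2) by blast
qed

section \<open>Integral coordinates\<close>

lemma common_denominator:
  assumes "finite (S :: rat set)"
  shows "\<exists>N::int. N > 0 \<and> (\<forall>q\<in>S. of_int N * q \<in> \<int>)"
  using assms
proof (induction S)
  case empty
  show ?case by (intro exI[of _ 1]) simp
next
  case (insert q S)
  then obtain N :: int where N: "N > 0" "\<forall>q\<in>S. of_int N * q \<in> \<int>" by blast
  obtain a m where q: "quotient_of q = (a, m)" by (cases "quotient_of q")
  have m: "m > 0" "of_int m * q = of_int a"
    using quotient_of_denom_pos[OF q] quotient_of_div[OF q] by auto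
  have "of_int (N * m) * q' \<in> \<int>" if "q' \<in> insert q S" for q'
  proof (cases "q' = q")
    case True
    then have "of_int (N * m) * q' = of_int (N * a)" by (simp add: m mult.assoc)
    then show ?thesis by (simp only: Ints_of_int)
  next
    case False
    then have "of_int N * q' \<in> \<int>" using that N by blast
    then have "of_int m * (of_int N * q') \<in> \<int>" by (rule Ints_mult[OF Ints_of_int])
    then show ?thesis by (simp add: mult_ac)
  qed
  then show ?case using N m by (intro exI[of _ "N * m"]) auto
qed

text \<open>
  With respect to a basis \<open>B \<subseteq> G\<close> of the rational span of \<open>G\<close>, the elements of \<open>G\<close> have rational
  coordinates with a common denominator \<open>N\<close>. Coordinates with respect to the vectors \<open>c / N\<close>, \<open>c \<in> B\<close>, are then
  integral on \<open>G\<close>, and \<open>H\<close> is the group of all vectors in the span for which they are.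
\<close>

lemma integer_coordinates:
  fixes G :: "'a::real_vector set"
  assumes G: "finite G"
  obtains H and s :: nat and b :: "nat \<Rightarrow> 'a" and \<phi> :: "nat \<Rightarrow> 'a \<Rightarrow> real"
  where "G \<subseteq> H"
    "\<And>x y. x \<in> H \<Longrightarrow> y \<in> H \<Longrightarrow> x + y \<in> H" "\<And>x y. x \<in> H \<Longrightarrow> y \<in> H \<Longrightarrow> x - y \<in> H"
    "\<And>i x y. x \<in> H \<Longrightarrow> y \<in> H \<Longrightarrow> \<phi> i (x - y) = \<phi> i x - \<phi> i y"
    "\<And>i x. i < s \<Longrightarrow> x \<in> H \<Longrightarrow> \<phi> i x \<in> \<int>"
    "\<And>x. x \<in> H \<Longrightarrow> x = (\<Sum>i<s. \<phi> i x *\<^sub>R b i)"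
proof -
  interpret Q: vector_space "\<lambda>q::rat. \<lambda>x::'a. of_rat q *\<^sub>R x"
    by unfold_locales (auto simp: of_rat_add of_rat_mult scaleR_add_left scaleR_add_right)
  obtain B where B: "B \<subseteq> G" "Q.independent B" "G \<subseteq> Q.span B"
    by (rule Q.maximal_independent_subset)
  have fB: "finite B" using B(1) G finite_subset by blast
  obtain N :: int where N: "N > 0" and
    "\<forall>q\<in>(\<lambda>(g, c). Q.representation B g c) ` (G \<times> B). of_int N * q \<in> \<int>"
    using common_denominator[of "(\<lambda>(g, c). Q.representation B g c) ` (G \<times> B)"] G fB by auto
  then have int: "of_int N * Q.representation B g c \<in> \<int>" if "g \<in> G" "c \<in> B" for g c
    using that by auto
  obtain \<beta> where \<beta>: "bij_betw \<beta> {..<card B} B"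
    using ex_bij_betw_nat_finite[OF fB] by (auto simp: lessThan_atLeast0)
  define H where "H = {x \<in> Q.span B. \<forall>c\<in>B. of_int N * Q.representation B x c \<in> \<int>}"
  define \<phi> :: "nat \<Rightarrow> 'a \<Rightarrow> real"
    where "\<phi> i x = of_rat (of_int N * Q.representation B x (\<beta> i))" for i x
  define b where "b i = (1 / of_int N :: real) *\<^sub>R \<beta> i" for i
  have rep_add: "Q.representation B (x + y) c = Q.representation B x c + Q.representation B y c"
    and rep_diff: "Q.representation B (x - y) c = Q.representation B x c - Q.representation B y c"
    if "x \<in> H" "y \<in> H" for x y c
    using that by (auto simp: H_def Q.representation_add[OF B(2)] Q.representation_diff[OF B(2)])
  show ?thesis
  proof (rule that[of H \<phi> "card B" b])
    show "G \<subseteq> H" using B(3) int by (auto simp: H_def)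
    show "x + y \<in> H" if "x \<in> H" "y \<in> H" for x y
      using that rep_add[OF that] by (auto simp: H_def Q.span_add distrib_left)
    show "x - y \<in> H" if "x \<in> H" "y \<in> H" for x y
      using that rep_diff[OF that] by (auto simp: H_def Q.span_diff right_diff_distrib)
    show "\<phi> i (x - y) = \<phi> i x - \<phi> i y" if "x \<in> H" "y \<in> H" for i x y
      by (simp add: \<phi>_def rep_diff[OF that] right_diff_distrib of_rat_diff)
    show "\<phi> i x \<in> \<int>" if "i < card B" "x \<in> H" for i x
    proof -
      have "\<beta> i \<in> B" using \<beta> that(1) by (auto simp: bij_betw_def)
      then have "of_int N * Q.representation B x (\<beta> i) \<in> \<int>" using that(2) by (auto simp: H_def)
      then obtain k where "of_int N * Q.representation B x (\<beta> i) = of_int k" by (auto elim: Ints_cases)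
      then show ?thesis by (simp add: \<phi>_def)
    qed
    show "x = (\<Sum>i<card B. \<phi> i x *\<^sub>R b i)" if "x \<in> H" for x
    proof -
      have "x = (\<Sum>c\<in>B. of_rat (Q.representation B x c) *\<^sub>R c)"
        using that Q.sum_representation_eq[OF B(2) _ fB order_refl, of x] by (simp add: H_def)
      also have "\<dots> = (\<Sum>i<card B. of_rat (Q.representation B x (\<beta> i)) *\<^sub>R \<beta> i)"
        by (rule sum.reindex_bij_betw[OF \<beta>, symmetric])
      also have "\<dots> = (\<Sum>i<card B. \<phi> i x *\<^sub>R b i)"
        using N by (simp add: \<phi>_def b_def of_rat_mult)
      finally show ?thesis .
    qed
  qed
qed

section \<open>Construction of the cut-and-project scheme\<close>

lemma openin_Euclidean_space_box:
  assumes "\<And>i. open (U i)"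
  shows "openin (Euclidean_space e) {y \<in> topspace (Euclidean_space e). \<forall>i<e. y i \<in> U i}"
proof -
  define X where "X i = (if i < e then U i else UNIV)" for i
  have "openin (powertop_real UNIV) (Pi\<^sub>E UNIV X)"
    unfolding openin_PiE_gen using assms
    by (auto simp: X_def intro!: disjI2 finite_subset[of _ "{..<e}"])
  moreover have "{y \<in> topspace (Euclidean_space e). \<forall>i<e. y i \<in> U i}
      = Pi\<^sub>E UNIV X \<inter> {x. \<forall>i\<ge>e. x i = 0}"
    by (auto simp: topspace_Euclidean_space X_def PiE_iff) metis
  ultimately show ?thesis unfolding Euclidean_space_def openin_subtopology by blast
qed

text \<open>
  The subgroup is the image of \<open>\<int>\<^sup>e\<close> under \<open>z \<mapsto> (\<psi> z, z - l (\<psi> z))\<close>. If the first component is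
  small, then so is \<open>l (\<psi> z)\<close>, hence a small second component forces the integers \<open>z i\<close> to be
  less than \<open>1\<close> in absolute value. On the kernel of \<open>\<psi>\<close> the second component is \<open>z\<close> itself.
\<close>

lemma discrete_subgroup_graph:
  fixes b :: "nat \<Rightarrow> real ^ 'd" and l :: "nat \<Rightarrow> real ^ 'd \<Rightarrow> real"
  assumes lin: "\<And>i. i < e \<Longrightarrow> linear (l i)"
  defines "\<psi> \<equiv> \<lambda>z. \<Sum>i<e. real_of_int (z i) *\<^sub>R b i"
  shows "discrete_subgroup e (range (\<lambda>z. (\<psi> z, \<lambda>i. if i < e then real_of_int (z i) - l i (\<psi> z) else 0)))"
proof -
  define \<gamma> where "\<gamma> z = (\<psi> z, \<lambda>i. if i < e then real_of_int (z i) - l i (\<psi> z) else 0)" for z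
  let ?T = "prod_topology euclidean (Euclidean_space e) :: ((real ^ 'd) \<times> (nat \<Rightarrow> real)) topology"
  have \<psi>_add: "\<psi> (\<lambda>i. z i + w i) = \<psi> z + \<psi> w" for z w
    by (simp add: \<psi>_def scaleR_add_left sum.distrib)
  have \<psi>_neg: "\<psi> (\<lambda>i. - z i) = - \<psi> z" for z
    by (simp add: \<psi>_def sum_negf)
  have \<psi>_0: "\<psi> (\<lambda>i. 0) = 0" by (simp add: \<psi>_def)
  have \<gamma>_add: "\<gamma> z + \<gamma> w = \<gamma> (\<lambda>i. z i + w i)" for z w
    using lin by (auto simp: \<gamma>_def \<psi>_add fun_eq_iff linear_add)
  have \<gamma>_neg: "- \<gamma> z = \<gamma> (\<lambda>i. - z i)" for z
    using lin by (auto simp: \<gamma>_def \<psi>_neg fun_eq_iff linear_neg)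
  have \<gamma>_0: "0 = \<gamma> (\<lambda>i. 0)"
    using lin by (auto simp: \<gamma>_def \<psi>_0 zero_prod_def fun_eq_iff linear_0)
  have sub: "range \<gamma> \<subseteq> UNIV \<times> topspace (Euclidean_space e)"
    by (auto simp: \<gamma>_def topspace_Euclidean_space)
  have "\<forall>i. \<exists>K. i < e \<longrightarrow> K \<ge> 0 \<and> (\<forall>x. \<bar>l i x\<bar> \<le> K * norm x)"
  proof
    fix i
    show "\<exists>K. i < e \<longrightarrow> K \<ge> 0 \<and> (\<forall>x. \<bar>l i x\<bar> \<le> K * norm x)"
    proof (cases "i < e")
      case True
      then have "bounded_linear (l i)" using lin by (simp add: linear_conv_bounded_linear)
      from bounded_linear.nonneg_bounded[OF this] show ?thesis by (auto simp: mult.commute)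
    qed simp
  qed
  then obtain k where k: "\<And>i. i < e \<Longrightarrow> k i \<ge> 0" "\<And>i x. i < e \<Longrightarrow> \<bar>l i x\<bar> \<le> k i * norm x" by metis
  \<comment> \<open>The choice makes \<open>\<epsilon> + K \<epsilon> = 1\<close> for the common bound \<open>K\<close> of the forms \<open>l i\<close>.\<close>
  define \<epsilon> where "\<epsilon> = 1 / (1 + (\<Sum>i<e. k i))"
  have K: "(\<Sum>i<e. k i) \<ge> 0" using k by (intro sum_nonneg) auto
  then have \<epsilon>: "\<epsilon> > 0" by (simp add: \<epsilon>_def)
  have iso: "\<gamma> z = 0" if close: "norm (fst (\<gamma> z)) < \<epsilon>" "\<And>i. i < e \<Longrightarrow> \<bar>snd (\<gamma> z) i\<bar> < \<epsilon>" for z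
  proof -
    have z: "z i = 0" if i: "i < e" for i
    proof -
      have "\<bar>l i (\<psi> z)\<bar> \<le> k i * norm (\<psi> z)" by (rule k(2)[OF i])
      also have "\<dots> \<le> (\<Sum>i<e. k i) * \<epsilon>"
        using close(1) k(1) i K by (intro mult_mono member_le_sum) (auto simp: \<gamma>_def)
      finally have "\<bar>real_of_int (z i)\<bar> < (1 + (\<Sum>i<e. k i)) * \<epsilon>"
        using close(2)[OF i] i by (simp add: \<gamma>_def distrib_right)
      then have "\<bar>real_of_int (z i)\<bar> < 1" using K by (simp add: \<epsilon>_def)
      then show ?thesis by linarith
    qed
    then have "\<psi> z = 0" by (simp add: \<psi>_def)
    then show ?thesis using z lin by (auto simp: \<gamma>_def zero_prod_def fun_eq_iff linear_0)
  qed
  have "openin (subtopology ?T (range \<gamma>)) {g}" if g: "g \<in> range \<gamma>" for g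
  proof -
    obtain z where z: "g = \<gamma> z" using g by blast
    define V where "V = {y \<in> topspace (Euclidean_space e). \<forall>i<e. y i \<in> ball (snd g i) \<epsilon>}"
    have V: "openin (Euclidean_space e) V" unfolding V_def by (rule openin_Euclidean_space_box) simp
    have "openin ?T (ball (fst g) \<epsilon> \<times> V)"
      using V by (simp add: openin_prod_Times_iff)
    moreover have "{g} = (ball (fst g) \<epsilon> \<times> V) \<inter> range \<gamma>"
    proof (intro equalityI subsetI)
      fix h assume "h \<in> (ball (fst g) \<epsilon> \<times> V) \<inter> range \<gamma>"
      then obtain w where w: "h = \<gamma> w" and h: "fst h \<in> ball (fst g) \<epsilon>" "snd h \<in> V"
        by (auto simp: mem_Times_iff)
      define d where "d = (\<lambda>i. w i + - z i)"
      have d: "\<gamma> d = h - g"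
        unfolding d_def w z \<gamma>_add[symmetric] \<gamma>_neg[symmetric] by simp
      have "\<gamma> d = 0"
      proof (rule iso)
        show "norm (fst (\<gamma> d)) < \<epsilon>" using h(1) by (simp add: d dist_norm norm_minus_commute)
        show "\<bar>snd (\<gamma> d) i\<bar> < \<epsilon>" if "i < e" for i
          using h(2) that by (auto simp: d V_def dist_real_def abs_minus_commute)
      qed
      then show "h \<in> {g}" using d by simp
    next
      fix h assume "h \<in> {g}"
      then show "h \<in> (ball (fst g) \<epsilon> \<times> V) \<inter> range \<gamma>"
        using g sub \<epsilon> by (auto simp: V_def mem_Times_iff)
    qed
    ultimately show ?thesis unfolding openin_subtopology by blast
  qed
  then have "subtopology ?T (range \<gamma>) = discrete_topology (range \<gamma>)"
    unfolding eq_commute[of _ "discrete_topology (range \<gamma>)"] discrete_topology_unique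
    using sub by auto
  then show ?thesis
    unfolding discrete_subgroup_def \<gamma>_def[symmetric]
    using sub \<gamma>_0 by (auto simp: \<gamma>_add \<gamma>_neg)
qed
text \<open>
  Every \<open>a \<in> A\<close> outside a fixed ball is \<open>2 h + g\<close> with \<open>h \<in> A\<close> within \<open>R\<close> of \<open>a / 2\<close>. The
  remainder \<open>g = a - h - h\<close> has norm at most \<open>2 R\<close>, and \<open>h\<close> is shorter than \<open>a\<close> by at least \<open>1\<close>
  as soon as the norm of \<open>a\<close> exceeds \<open>2 R + 2\<close>.
\<close>

lemma relatively_dense_finitely_generated:
  assumes R: "R > 0" and p: "\<And>x. p x \<in> A" "\<And>x. infnorm (p x - x) \<le> R"
    and H: "\<And>x y. x \<in> H \<Longrightarrow> y \<in> H \<Longrightarrow> x + y \<in> H"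
    and near: "\<And>a. a \<in> A \<Longrightarrow> infnorm a \<le> 2 * R + 2 \<Longrightarrow> a \<in> H"
    and gen: "\<And>x. x \<in> difference_set (difference_set A A) A \<Longrightarrow> infnorm x \<le> 2 * R \<Longrightarrow> x \<in> H"
  shows "A \<subseteq> H"
proof -
  have "\<forall>a\<in>A. infnorm a \<le> real n + (2 * R + 2) \<longrightarrow> a \<in> H" for n
  proof (induction n)
    case 0
    then show ?case using near by simp
  next
    case (Suc n)
    show ?case
    proof (intro ballI impI)
      fix a assume a: "a \<in> A" "infnorm a \<le> real (Suc n) + (2 * R + 2)"
      show "a \<in> H"
      proof (cases "infnorm a \<le> 2 * R + 2")
        case False
        define h where "h = p ((1/2) *\<^sub>R a)"
        define g where "g = (a - h) - h"
        have h: "h \<in> A" "infnorm (h - (1/2) *\<^sub>R a) \<le> R" using p by (auto simp: h_def)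
        have "g = (- 2) *\<^sub>R (h - (1/2) *\<^sub>R a)" by (simp add: g_def algebra_simps scaleR_2)
        then have "infnorm g = 2 * infnorm (h - (1/2) *\<^sub>R a)" by (simp only: infnorm_mul)
        then have "g \<in> H" using h a by (intro gen) (auto simp: g_def intro!: difference_setI)
        have "infnorm h \<le> infnorm (h - (1/2) *\<^sub>R a) + infnorm ((1/2) *\<^sub>R a)"
          using infnorm_triangle[of "h - (1/2) *\<^sub>R a" "(1/2) *\<^sub>R a"] by simp
        also have "infnorm ((1/2) *\<^sub>R a) = infnorm a / 2" by (simp add: infnorm_mul)
        finally have "infnorm h \<le> real n + (2 * R + 2)" using h(2) a(2) False by simp
        then have "h \<in> H" using Suc h(1) by blast
        then have "h + h + g \<in> H" using \<open>g \<in> H\<close> H by blast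
        then show ?thesis by (simp add: g_def)
      qed (use near a in blast)
    qed
  qed
  moreover have "\<exists>n. infnorm a \<le> real n + (2 * R + 2)" for a
  proof -
    obtain n where "infnorm a \<le> real n" using real_arch_simple by blast
    then show ?thesis using R by (intro exI[of _ n]) simp
  qed
  ultimately show ?thesis by blast
qed

text \<open>
  The coordinates \<open>\<phi> i\<close> are bounded on every set \<open>{x \<in> S. infnorm x \<le> \<rho>}\<close> with \<open>S\<close> one of \<open>A\<close>,
  \<open>A - A\<close> and \<open>A - A - A\<close>, because these sets are finite. Applied to
  \<open>p (u + v) - p u - p v\<close>, to \<open>p (t v)\<close> and to \<open>a - p a\<close>, these bounds give the two hypotheses of
  Hyers's theorem for \<open>v \<mapsto> \<phi> i (p v)\<close> and the comparison of \<open>\<phi> i a\<close> with \<open>\<phi> i (p a)\<close>.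
\<close>

lemma finite_on_balls_imp_subset_cut_and_project:
  fixes A :: "(real ^ 'd) set"
  assumes dense: "relatively_dense A"
    and E: "finite_on_balls (difference_set (difference_set A A) (difference_set A A))"
  shows "\<exists>M. cut_and_project M \<and> A \<subseteq> M"
proof -
  define D where "D = difference_set A A"
  have D: "finite_on_balls D" and A: "finite_on_balls A" and DA: "finite_on_balls (difference_set D A)"
    using finite_on_balls_triple_difference[OF E]
      finite_on_balls_difference_imp_uniformly_discrete[OF E]
      finite_on_balls_difference_imp_uniformly_discrete[of A]
    by (auto simp: D_def intro: uniformly_discrete_imp_finite_on_balls)
  obtain R p where R: "R > 0" and p: "\<And>x. p x \<in> A" "\<And>x. infnorm (p x - x) \<le> R"
    by (rule relatively_dense_obtain[OF dense]) (rule that)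
  \<comment> \<open>\<open>A\<close> lies in the group generated by this set, by repeated halving.\<close>
  define G where "G = {a \<in> A. infnorm a \<le> 2 * R + 2} \<union> {x \<in> difference_set D A. infnorm x \<le> 2 * R}"
  have "finite G" using A DA by (auto simp: G_def finite_on_ballsD)
  then obtain H and s :: nat and b :: "nat \<Rightarrow> real ^ 'd" and \<phi> :: "nat \<Rightarrow> real ^ 'd \<Rightarrow> real"
    where GH: "G \<subseteq> H"
    and Hadd: "\<And>x y. x \<in> H \<Longrightarrow> y \<in> H \<Longrightarrow> x + y \<in> H"
    and Hdiff: "\<And>x y. x \<in> H \<Longrightarrow> y \<in> H \<Longrightarrow> x - y \<in> H"
    and \<phi>_diff: "\<And>i x y. x \<in> H \<Longrightarrow> y \<in> H \<Longrightarrow> \<phi> i (x - y) = \<phi> i x - \<phi> i y"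
    and \<phi>_int: "\<And>i x. i < s \<Longrightarrow> x \<in> H \<Longrightarrow> \<phi> i x \<in> \<int>"
    and \<phi>_sum: "\<And>x. x \<in> H \<Longrightarrow> x = (\<Sum>i<s. \<phi> i x *\<^sub>R b i)"
    by (rule integer_coordinates) (rule that)
  have AH: "A \<subseteq> H"
    by (rule relatively_dense_finitely_generated[OF R p Hadd]) (use GH in \<open>auto simp: G_def D_def\<close>)
  have bound: "\<exists>M\<ge>0. \<forall>x\<in>S. infnorm x \<le> \<rho> \<longrightarrow> \<bar>\<phi> i x\<bar> \<le> M" if "finite_on_balls S" for S \<rho> i
  proof (intro exI conjI ballI impI)
    let ?S = "{x \<in> S. infnorm x \<le> \<rho>}"
    show "0 \<le> (\<Sum>x\<in>?S. \<bar>\<phi> i x\<bar>)" by (intro sum_nonneg) simp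
    fix x assume "x \<in> S" "infnorm x \<le> \<rho>"
    then show "\<bar>\<phi> i x\<bar> \<le> (\<Sum>x\<in>?S. \<bar>\<phi> i x\<bar>)"
      using finite_on_ballsD[OF that] by (intro member_le_sum) auto
  qed
  have "\<exists>l C. linear l \<and> C \<ge> 0 \<and> (\<forall>a\<in>A. \<bar>\<phi> i a - l a\<bar> \<le> C)" for i
  proof -
    define f where "f v = \<phi> i (p v)" for v
    obtain C1 where C1: "\<And>x. x \<in> difference_set D A \<Longrightarrow> infnorm x \<le> 3 * R \<Longrightarrow> \<bar>\<phi> i x\<bar> \<le> C1"
      using bound[OF DA, of "3 * R" i] by blast
    obtain C2 where C2: "C2 \<ge> 0" "\<And>x. x \<in> D \<Longrightarrow> infnorm x \<le> R \<Longrightarrow> \<bar>\<phi> i x\<bar> \<le> C2"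
      using bound[OF D, of R i] by blast
    have qa: "\<bar>f (u + v) - f u - f v\<bar> \<le> C1" for u v
    proof -
      let ?t = "p (u + v) - p u - p v"
      have t: "?t = (p (u + v) - (u + v)) + ((u - p u) + (v - p v))" by (simp add: algebra_simps)
      have "infnorm ?t \<le> infnorm (p (u + v) - (u + v)) + infnorm ((u - p u) + (v - p v))"
        unfolding t by (rule infnorm_triangle)
      also have "\<dots> \<le> infnorm (p (u + v) - (u + v)) + (infnorm (u - p u) + infnorm (v - p v))"
        by (intro add_left_mono infnorm_triangle)
      also have "\<dots> \<le> 3 * R" using p(2)[of "u + v"] p(2)[of u] p(2)[of v]
        by (simp add: infnorm_sub[of u] infnorm_sub[of v])
      finally have "\<bar>\<phi> i ?t\<bar> \<le> C1" 
        by (intro C1) (auto simp: D_def intro!: difference_setI p)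
      moreover have "p x \<in> H" for x using p(1) AH by blast
      ultimately show ?thesis by (simp add: f_def \<phi>_diff Hdiff)
    qed
    have bdd: "\<exists>M. \<forall>t\<in>{0..1}. \<bar>f (t *\<^sub>R v)\<bar> \<le> M" for v
    proof -
      obtain M where M: "\<And>x. x \<in> A \<Longrightarrow> infnorm x \<le> R + infnorm v \<Longrightarrow> \<bar>\<phi> i x\<bar> \<le> M"
        using bound[OF A] by blast
      have "\<bar>f (t *\<^sub>R v)\<bar> \<le> M" if "t \<in> {0..1}" for t
        unfolding f_def
      proof (rule M[OF p(1)])
        have "infnorm (p (t *\<^sub>R v)) \<le> infnorm (p (t *\<^sub>R v) - t *\<^sub>R v) + infnorm (t *\<^sub>R v)"
          using infnorm_triangle[of "p (t *\<^sub>R v) - t *\<^sub>R v" "t *\<^sub>R v"] by simp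
        also have "infnorm (t *\<^sub>R v) \<le> 1 * infnorm v"
          unfolding infnorm_mul using that by (intro mult_right_mono infnorm_pos_le) auto
        finally show "infnorm (p (t *\<^sub>R v)) \<le> R + infnorm v" using p(2)[of "t *\<^sub>R v"] by simp
      qed
      then show ?thesis by blast
    qed
    obtain l where l: "linear l" "\<And>v. \<bar>f v - l v\<bar> \<le> C1"
      using quasi_additive_near_linear[OF qa bdd] by blast
    have "C1 \<ge> 0" using l(2)[of 0] by linarith
    have "\<bar>\<phi> i a - l a\<bar> \<le> C1 + C2" if a: "a \<in> A" for a
    proof -
      have "\<bar>\<phi> i (a - p a)\<bar> \<le> C2"
        using p(2)[of a] by (intro C2) (auto simp: D_def infnorm_sub intro!: difference_setI a p)
      then have "\<bar>\<phi> i a - f a\<bar> \<le> C2" using a p(1)[of a] AH by (simp add: f_def \<phi>_diff subset_iff)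
      then show ?thesis using l(2)[of a] by linarith
    qed
    then show ?thesis using l(1) \<open>C1 \<ge> 0\<close> C2(1) by (intro exI[of _ l] exI[of _ "C1 + C2"]) auto
  qed
  then obtain l C where l: "\<And>i. linear (l i)" and C0: "\<And>i. C i \<ge> 0"
    and C: "\<And>i a. a \<in> A \<Longrightarrow> \<bar>\<phi> i a - l i a\<bar> \<le> C i" by metis
  define \<psi> where "\<psi> z = (\<Sum>i<s. real_of_int (z i) *\<^sub>R b i)" for z :: "nat \<Rightarrow> int"
  define \<gamma> where "\<gamma> z = (\<psi> z, \<lambda>i. if i < s then real_of_int (z i) - l i (\<psi> z) else 0)" for z
  define B where "B = (\<Sum>i<s. C i) + 1"
  define \<Omega> where "\<Omega> = {y \<in> topspace (Euclidean_space s). \<forall>i<s. y i \<in> ball 0 B}"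
  have "discrete_subgroup s (range \<gamma>)"
    using discrete_subgroup_graph[of s l b] l unfolding \<gamma>_def \<psi>_def by blast
  moreover have "openin (Euclidean_space s) \<Omega>" unfolding \<Omega>_def by (rule openin_Euclidean_space_box) simp
  moreover have "bounded_Euclidean s \<Omega>"
    unfolding bounded_Euclidean_def \<Omega>_def by (intro exI[of _ B]) (auto simp: dist_norm)
  ultimately have "cut_and_project (fst ` (range \<gamma> \<inter> (UNIV \<times> \<Omega>)))"
    unfolding cut_and_project_def by blast
  moreover have "A \<subseteq> fst ` (range \<gamma> \<inter> (UNIV \<times> \<Omega>))"
  proof
    fix a assume a: "a \<in> A"
    then have aH: "a \<in> H" using AH by blast
    define z where "z i = \<lfloor>\<phi> i a\<rfloor>" for i
    have z: "real_of_int (z i) = \<phi> i a" if "i < s" for i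
      using \<phi>_int[OF that aH] by (simp add: z_def)
    have \<psi>: "\<psi> z = a" using \<phi>_sum[OF aH] by (simp add: \<psi>_def z)
    have "snd (\<gamma> z) i \<in> ball 0 B" if i: "i < s" for i
    proof -
      have "\<bar>\<phi> i a - l i a\<bar> \<le> C i" by (rule C[OF a])
      also have "C i \<le> (\<Sum>i<s. C i)" using C0 i by (intro member_le_sum) auto
      finally show ?thesis using i by (simp add: \<gamma>_def \<psi> z B_def)
    qed
    then have "snd (\<gamma> z) \<in> \<Omega>" by (auto simp: \<Omega>_def topspace_Euclidean_space \<gamma>_def)
    then have "\<gamma> z \<in> range \<gamma> \<inter> (UNIV \<times> \<Omega>)" by (simp add: mem_Times_iff)
    moreover have "fst (\<gamma> z) = a" by (simp add: \<gamma>_def \<psi>)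
    ultimately show "a \<in> fst ` (range \<gamma> \<inter> (UNIV \<times> \<Omega>))" by (metis imageI)
  qed
  ultimately show ?thesis by blast
qed

section \<open>Equivalence of the four conditions\<close>

theorem theorem1p1:
  fixes A :: "(real ^ 'd) set"
  assumes "relatively_dense A"
  shows "(upper_uniform_density (difference_set A A) < \<infinity> \<longleftrightarrow>
            uniformly_discrete (difference_set A A)) \<and>
         (uniformly_discrete (difference_set A A) \<longleftrightarrow>
            uniformly_discrete A \<and> (\<exists>F. finite F \<and> difference_set A A \<subseteq> A + F)) \<and>
         (uniformly_discrete A \<and> (\<exists>F. finite F \<and> difference_set A A \<subseteq> A + F) \<longleftrightarrow>
            (\<exists>M F. cut_and_project M \<and> finite F \<and> A \<subseteq> M + F))"
    (is "(?density \<longleftrightarrow> ?discrete) \<and> (?discrete \<longleftrightarrow> ?Lagarias) \<and> (?Lagarias \<longleftrightarrow> ?model)")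
proof -
  \<comment> \<open>All four conditions are compared with this one.\<close>
  let ?hub = "finite_on_balls (difference_set (difference_set A A) (difference_set A A))"
  have hub_discrete: "?hub \<Longrightarrow> ?discrete"
    by (rule finite_on_balls_difference_imp_uniformly_discrete)
  have "?discrete \<Longrightarrow> ?density" by (rule uniformly_discrete_imp_finite_upper_uniform_density)
  moreover have "?density \<Longrightarrow> ?hub"
    by (rule finite_density_difference_imp_finite_on_balls[OF assms])
  moreover have "?hub \<Longrightarrow> ?Lagarias"
    using hub_discrete difference_set_subset_plus_finite[OF assms]
      uniformly_discrete_imp_finite_on_balls finite_on_balls_difference_imp_uniformly_discrete by blast
  moreover have "?Lagarias \<Longrightarrow> ?hub"
    using difference_set_subset_plus_finite_imp_finite_on_balls by blast
  moreover have "?model" if h: ?hub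
  proof -
    obtain M where "cut_and_project M" "A \<subseteq> M"
      using finite_on_balls_imp_subset_cut_and_project[OF assms h] by blast
    then show ?thesis by (intro exI[of _ M] exI[of _ "{0}"]) simp
  qed
  moreover have "?model \<Longrightarrow> ?hub"
    using cut_and_project_imp_finite_on_balls by blast
  ultimately show ?thesis using hub_discrete by blast
qed

end
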